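(* Let $\Omega\subset\mathbb{C}^n$ be a bounded domain with $\mathcal{C}^2$-smooth strongly convex boundary. Then for every $p\in\partial\Omega$, $\displaystyle\lim_{\Omega\ni q\to p}\sigma_\Omega(q)=1$.
   Context: For $q\in\mathbb{C}^n$ and $r>0$ let $\mathbb{B}^n(q;r)=\{z\in\mathbb{C}^n:\|z-q\|<r\}$ (Euclidean norm) and $\mathbb{B}^n=\mathbb{B}^n(0;1)$. For a complex manifold $\Omega$ of dimension $n$ and $p\in\Omega$, let $\mathcal{F}(p,\Omega)$ be the set of injective holomorphic maps $f:\Omega\to\mathbb{B}^n$ with $f(p)=0$. The squeezing function is $\sigma_\Omega(p)=\sup\{r>0:\ \mathbb{B}^n(0;r)\subset f(\Omega)\text{ for some }f\in\mathcal{F}(p,\Omega)\}$. A bounded domain has $\mathcal{C}^2$ strongly convex boundary if it has a $\mathcal{C}^2$ defining function $\rho$ ($\Omega=\{\rho<0\}$, $d\rho\ne0$ on $\partial\Omega$) whose real Hessian is positive definite on the real tangent space of $\partial\Omega$ at every boundary point. *)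

theory Defs
  imports "HOL-Analysis.Analysis"
begin

definition holo_on :: "(complex ^ 'n \<Rightarrow> complex ^ 'm) \<Rightarrow> (complex ^ 'n) set \<Rightarrow> bool" where
  "holo_on f S \<longleftrightarrow> (\<forall>z\<in>S. \<exists>D. (f has_derivative D) (at z) \<and> (\<forall>v. D (\<i> *s v) = \<i> *s D v))"


definition squeeze_maps :: "complex ^ 'n \<Rightarrow> (complex ^ 'n) set \<Rightarrow> (complex ^ 'n \<Rightarrow> complex ^ 'n) set" where
  "squeeze_maps p \<Omega> = {f. inj_on f \<Omega> \<and> holo_on f \<Omega> \<and> f ` \<Omega> \<subseteq> ball 0 1 \<and> f p = 0}"

definition squeezing :: "(complex ^ 'n) set \<Rightarrow> complex ^ 'n \<Rightarrow> real" where
  "squeezing \<Omega> p = Sup {r. r > 0 \<and> (\<exists>f\<in>squeeze_maps p \<Omega>. ball 0 r \<subseteq> f ` \<Omega>)}"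

definition C2_defining_function ::
  "(complex ^ 'n) set \<Rightarrow> (complex ^ 'n \<Rightarrow> real) \<Rightarrow> (complex ^ 'n \<Rightarrow> complex ^ 'n)
   \<Rightarrow> (complex ^ 'n \<Rightarrow> ((complex ^ 'n) \<Rightarrow>\<^sub>L (complex ^ 'n))) \<Rightarrow> bool" where
  "C2_defining_function \<Omega> \<rho> g H \<longleftrightarrow>
     (\<forall>x. (\<rho> has_derivative (\<lambda>v. g x \<bullet> v)) (at x)) \<and>
     (\<forall>x. (g has_derivative blinfun_apply (H x)) (at x)) \<and>
     continuous_on UNIV H \<and>
     \<Omega> = {x. \<rho> x < 0} \<and>
     (\<forall>x\<in>frontier \<Omega>. g x \<noteq> 0)"

definition strongly_convex_C2_boundary :: "(complex ^ 'n) set \<Rightarrow> bool" where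
  "strongly_convex_C2_boundary \<Omega> \<longleftrightarrow>
     (\<exists>\<rho> g H. C2_defining_function \<Omega> \<rho> g H \<and>
        (\<forall>x\<in>frontier \<Omega>. \<forall>v. v \<noteq> 0 \<and> g x \<bullet> v = 0 \<longrightarrow> blinfun_apply (H x) v \<bullet> v > 0))"

end

theory Submission
  imports Defs
begin

text \<open>Let \<open>x\<close> be the boundary point nearest to \<open>q\<close> and \<open>\<nu>\<close> the inner normal there. Write points as
  \<open>x + v\<close> with \<open>v = \<zeta> \<nu> + v'\<close>, where \<open>\<zeta> = \<langle>v, \<nu>\<rangle>\<close>; near \<open>x\<close> the domain is \<open>L v' + 2 Re (h v') < 2 Re \<zeta>\<close> up to higher
  order, with \<open>L\<close> the Levi form and \<open>h\<close> a holomorphic quadratic form. For a large constant \<open>K\<close> put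
  \<open>\<sigma> = \<zeta> + K \<zeta>\<^sup>2 - h v'\<close>. Strong convexity gives \<open>Re \<zeta> > 0\<close> on the whole domain, so that
  \<open>(\<sigma>, v')\<close> are injective coordinates, and \<open>\<bar>\<sigma>\<bar> \<ge> c' \<bar>\<zeta>\<bar>\<close> everywhere. With \<open>t = \<sigma>(q)\<close>, the Cayley
  transform \<open>((t - \<sigma>) / (t + \<sigma>), sqrt t v' / (t + \<sigma>))\<close>, followed by a linear map turning
  \<open>\<bar>a\<bar>\<^sup>2 + 2 L w\<close> into the Euclidean norm, sends \<open>q\<close> to \<open>0\<close>. Points with \<open>\<bar>\<zeta>\<bar> \<ge> R t\<close> land close to
  the boundary point \<open>(-1, 0)\<close> of the ball; for the others the Taylor expansion shows that the image is a ball up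
  to \<open>\<epsilon>\<close>. All constants are uniform in \<open>x\<close>.\<close>

section \<open>Complex scalar multiplication on \<open>complex ^ 'n\<close>\<close>

lemma norm_vector_smult: "norm (c *s v) = cmod c * norm v" for v :: "complex ^ 'n"
  by (simp add: norm_vec_def norm_mult L2_set_right_distrib)

lemma complex_smult_eq: "c *s v = Re c *\<^sub>R v + Im c *\<^sub>R (\<i> *s v)" for v :: "complex ^ 'n"
  by (simp add: vec_eq_iff complex_eq_iff)

lemma scaleR_eq_smult: "r *\<^sub>R v = complex_of_real r *s v" for v :: "complex ^ 'n"
  by (simp add: vec_eq_iff scaleR_conv_of_real[where 'a=complex])

lemma ii_smult: "\<i> *s (\<i> *s v) = - v" for v :: "complex ^ 'n"
  by (simp add: vec_eq_iff)

lemma ii_scaleR: "\<i> *s (r *\<^sub>R v) = r *\<^sub>R (\<i> *s v)" for v :: "complex ^ 'n"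
  by (simp add: vec_eq_iff)

lemma bounded_bilinear_smult: "bounded_bilinear ((*s) :: complex \<Rightarrow> complex ^ 'n \<Rightarrow> complex ^ 'n)"
proof
  show "\<exists>K. \<forall>a b. norm (a *s b :: complex ^ 'n) \<le> norm a * norm b * K"
    by (rule exI[of _ 1]) (simp add: norm_vector_smult)
qed (simp_all add: vec_eq_iff algebra_simps)

subsection \<open>Hermitian forms\<close>

text \<open>Gram-Schmidt. Such a \<open>b\<close> is the real part of the Hermitian form
  \<open>hb\<close>; an \<open>hb\<close>-orthonormal family \<open>u\<close> gives a complex linear
  isometry \<open>U\<close> from the Euclidean norm to \<open>b\<close>, and \<open>T\<close> is its
  inverse.\<close>

lemma hermitian_form_unitary_coordinates:
  fixes b :: "complex ^ 'n \<Rightarrow> complex ^ 'n \<Rightarrow> real"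
  assumes bil: "bounded_bilinear b" and sym: "\<And>v w. b v w = b w v"
    and inv: "\<And>v w. b (\<i> *s v) (\<i> *s w) = b v w"
    and pos: "\<And>v. v \<noteq> 0 \<Longrightarrow> b v v > 0"
  obtains T :: "complex ^ 'n \<Rightarrow> complex ^ 'n" where "linear T" "bij T" "\<And>v. T (\<i> *s v) = \<i> *s T v"
    "\<And>v. (norm (T v))\<^sup>2 = b v v"
proof -
  interpret b: bounded_bilinear b by (rule bil)
  define hb where "hb v w = Complex (b v w) (b v (\<i> *s w))" for v w
  have inv2: "b (\<i> *s v) w = - b v (\<i> *s w)" for v w
  proof -
    have "\<i> *s (\<i> *s v) = - v" by (simp add: vec_eq_iff)
    with inv[of "\<i> *s v" w] show ?thesis by (simp add: b.minus_left)
  qed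
  have hb_i: "hb (\<i> *s v) w = \<i> * hb v w" for v w
    by (simp add: hb_def complex_eq_iff inv inv2 ii_smult b.minus_right)
  have hb_sym: "hb w v = cnj (hb v w)" for v w
    using inv2[of v w] sym[of w "\<i> *s v"] by (simp add: hb_def complex_eq_iff sym[of w v])
  have hb_add: "hb (v + v') w = hb v w + hb v' w" for v v' w
    by (simp add: hb_def complex_eq_iff b.add_left)
  have hb_scale: "hb (r *\<^sub>R v) w = r *\<^sub>R hb v w" for r v w
    by (simp add: hb_def complex_eq_iff b.scaleR_left)
  have hb_smult: "hb (c *s v) w = c * hb v w" for c v w
    by (subst complex_smult_eq)
      (simp add: hb_add hb_scale hb_i complex_eq_iff)
  have hb_smult2: "hb v (c *s w) = cnj c * hb v w" for c v w
    by (metis hb_sym hb_smult complex_cnj_mult complex_cnj_cnj)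
  have hb_lin: "linear (\<lambda>v. hb v w)" for w
    by (rule linearI) (simp_all add: hb_add hb_scale)
  have hb_sum: "hb (\<Sum>i\<in>A. f i) w = (\<Sum>i\<in>A. hb (f i) w)" for A :: "'n set" and f w
    using linear_sum[OF hb_lin] by blast
  have hb_sum2: "hb w (\<Sum>i\<in>A. f i) = (\<Sum>i\<in>A. hb w (f i))" for A :: "'n set" and f w
    by (subst hb_sym, subst hb_sum) (simp add: hb_sym[of w])
  have "\<exists>u. \<forall>i\<in>I. \<forall>j\<in>I. hb (u i) (u j) = (if i = j then 1 else 0)" for I :: "'n set"
    using finite[of I]
  proof (induction I rule: finite_induct)
    case empty
    then show ?case by simp
  next
    case (insert k I)
    then obtain u where u: "\<forall>i\<in>I. \<forall>j\<in>I. hb (u i) (u j) = (if i = j then 1 else 0)" by blast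
    \<comment> \<open>All values of \<open>f\<close> have zero coordinate \<open>k\<close>, so
      \<open>f\<close> is not onto and, being a linear endomorphism, has a nonzero kernel vector.
      That vector is \<open>hb\<close>-orthogonal to the family found so far.\<close>
    define f where "f x = (\<chi> i. if i \<in> I then hb x (u i) else 0)" for x
    have f: "linear f"
      by (rule linearI) (simp_all add: f_def vec_eq_iff hb_add hb_scale)
    have "axis k 1 \<notin> range f"
    proof
      assume "axis k 1 \<in> range f"
      then obtain x where "axis k 1 = f x" by blast
      from arg_cong[OF this, of "\<lambda>y. y $ k"] insert.hyps show False
        by (simp add: f_def axis_def)
    qed
    then have "\<not> inj f"
      using linear_injective_imp_surjective[OF f] by auto
    then obtain x where x: "x \<noteq> 0" "f x = 0"
      using linear_injective_0[OF f] by blast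
    define y where "y = (1 / sqrt (b x x)) *\<^sub>R x"
    have px: "b x x > 0" using pos x by blast
    have y_I: "hb y (u i) = 0" if "i \<in> I" for i
      using that x(2) by (simp add: y_def hb_scale f_def vec_eq_iff) metis
    have "b y y = 1" using px by (simp add: y_def b.scaleR_left b.scaleR_right)
    moreover have "b y (\<i> *s y) = 0" using inv2[of y y] sym[of "\<i> *s y" y] by simp
    ultimately have yy: "hb y y = 1" by (simp add: hb_def complex_eq_iff)
    have y_I': "hb (u i) y = 0" if "i \<in> I" for i
      using y_I[OF that] hb_sym[of "u i" y] by simp
    show ?case
      by (rule exI[of _ "u(k := y)"]) (use insert.hyps u yy y_I y_I' in auto)
  qed
  from this[of UNIV] obtain u :: "'n \<Rightarrow> complex ^ 'n"
    where u: "\<And>i j. hb (u i) (u j) = (if i = j then 1 else 0)" by auto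
  define U where "U w = (\<Sum>i\<in>UNIV. w $ i *s u i)" for w :: "complex ^ 'n"
  have U_lin: "linear U"
    by (rule linearI)
      (simp_all add: U_def vec_eq_iff sum.distrib ring_distribs scaleR_sum_right)
  have U_i: "U (\<i> *s w) = \<i> *s U w" for w
    by (simp add: U_def vec_eq_iff sum_distrib_left mult.assoc)
  have "hb (U w) (U w) = (\<Sum>i\<in>UNIV. w $ i * cnj (w $ i))" for w
    by (simp add: U_def hb_sum hb_sum2 hb_smult hb_smult2 u if_distrib mult.commute cong: if_cong)
  then have "Re (hb (U w) (U w)) = Re (\<Sum>i\<in>UNIV. w $ i * cnj (w $ i))" for w by simp
  then have U_norm: "b (U w) (U w) = (norm w)\<^sup>2" for w
    by (simp add: hb_def norm_vec_def L2_set_def complex_mult_cnj cmod_power2 sum_nonneg)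
  have U_inj: "inj U"
    unfolding linear_injective_0[OF U_lin] by (metis U_norm b.zero_left zero_eq_power2 norm_eq_zero)
  then have U_surj: "surj U" using linear_injective_imp_surjective[OF U_lin] by blast
  define T where "T = inv U"
  have UT: "U (T v) = v" for v by (simp add: T_def U_surj surj_f_inv_f)
  have TU: "T (U v) = v" for v by (simp add: T_def U_inj)
  show ?thesis
  proof
    show "linear T"
    proof (rule linearI)
      show "T (v + w) = T v + T w" for v w
        by (metis TU UT linear_add[OF U_lin])
      show "T (r *\<^sub>R v) = r *\<^sub>R T v" for r v
        by (metis TU UT linear_scale[OF U_lin])
    qed
    show "bij T" unfolding T_def using U_inj U_surj by (simp add: bij_def bij_imp_bij_inv inj_imp_surj_inv surj_imp_inj_inv)
    show "T (\<i> *s v) = \<i> *s T v" for v by (metis TU UT U_i)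
    show "(norm (T v))\<^sup>2 = b v v" for v using U_norm[of "T v"] by (simp add: UT)
  qed
qed

subsection \<open>Splitting off a complex line\<close>

text \<open>The Hermitian product with \<open>\<nu>\<close>, linear in \<open>v\<close>. For a unit
  normal \<open>\<nu>\<close> it is the complex normal coordinate, and \<open>tp\<close> is the
  projection to the complex tangent space.\<close>

definition zc :: "complex ^ 'n \<Rightarrow> complex ^ 'n \<Rightarrow> complex" where
  "zc \<nu> v = (\<Sum>i\<in>UNIV. v $ i * cnj (\<nu> $ i))"

definition tp :: "complex ^ 'n \<Rightarrow> complex ^ 'n \<Rightarrow> complex ^ 'n" where
  "tp \<nu> v = v - zc \<nu> v *s \<nu>"

lemma zc_add: "zc \<nu> (v + w) = zc \<nu> v + zc \<nu> w"
  by (simp add: zc_def sum.distrib ring_distribs)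

lemma zc_smult: "zc \<nu> (c *s v) = c * zc \<nu> v"
  by (simp add: zc_def sum_distrib_left mult.assoc)

lemma zc_scaleR: "zc \<nu> (r *\<^sub>R v) = r *\<^sub>R zc \<nu> v"
  by (simp add: scaleR_eq_smult zc_smult scaleR_conv_of_real)

lemma linear_zc: "linear (zc \<nu>)"
  by (rule linearI) (simp_all add: zc_add zc_scaleR)

lemma zc_self: "norm \<nu> = 1 \<Longrightarrow> zc \<nu> \<nu> = 1"
proof -
  assume "norm \<nu> = 1"
  then have "(\<Sum>i\<in>UNIV. (cmod (\<nu> $ i))\<^sup>2) = 1"
    by (simp add: norm_vec_def L2_set_def)
  then show "zc \<nu> \<nu> = 1"
    by (simp add: zc_def complex_norm_square[symmetric] flip: of_real_sum of_real_power)
qed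

lemma Re_zc: "Re (zc \<nu> v) = \<nu> \<bullet> v"
  by (simp add: zc_def inner_vec_def inner_complex_def mult.commute)

lemma linear_tp: "linear (tp \<nu>)"
  by (rule linearI) (simp_all add: tp_def zc_add zc_scaleR vec_eq_iff algebra_simps)

lemma tp_smult: "tp \<nu> (c *s v) = c *s tp \<nu> v"
  by (simp add: tp_def zc_smult vec_eq_iff algebra_simps)

lemma zc_tp: "norm \<nu> = 1 \<Longrightarrow> zc \<nu> (tp \<nu> v) = 0"
  using zc_self[of \<nu>] linear_diff[OF linear_zc, of \<nu> v "zc \<nu> v *s \<nu>"]
  by (simp add: tp_def zc_smult)

lemma zc_tp_decomp: "v = zc \<nu> v *s \<nu> + tp \<nu> v"
  by (simp add: tp_def)

lemma zc_tp_parts: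
  assumes "norm \<nu> = 1" "zc \<nu> w = 0"
  shows "zc \<nu> (a *s \<nu> + w) = a" "tp \<nu> (a *s \<nu> + w) = w"
  using assms zc_self[of \<nu>] by (simp_all add: tp_def zc_add zc_smult)

lemma norm_zc_tp:
  assumes "norm \<nu> = 1"
  shows "(norm v)\<^sup>2 = (cmod (zc \<nu> v))\<^sup>2 + (norm (tp \<nu> v))\<^sup>2"
proof -
  let ?a = "zc \<nu> v" and ?w = "tp \<nu> v"
  have "\<nu> \<bullet> (c *s ?w) = 0" for c
    using zc_tp[OF assms, of v] by (simp flip: Re_zc add: zc_smult)
  \<comment> \<open>Moving the scalar to the other factor reduces the claim to orthogonality of
    \<open>\<nu>\<close> to all complex multiples of the tangential part.\<close>
  moreover have "(?a *s \<nu>) \<bullet> ?w = \<nu> \<bullet> (cnj ?a *s ?w)"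
    by (simp add: inner_vec_def inner_complex_def algebra_simps)
  ultimately have orth: "(?a *s \<nu>) \<bullet> ?w = 0" by simp
  have "(norm v)\<^sup>2 = (norm (?a *s \<nu> + ?w))\<^sup>2" by (simp flip: zc_tp_decomp)
  also have "\<dots> = (norm (?a *s \<nu>))\<^sup>2 + (norm ?w)\<^sup>2"
    using orth by (simp add: power2_norm_eq_inner inner_simps inner_commute)
  finally show ?thesis using assms by (simp add: norm_vector_smult)
qed

lemma norm_zc_le: "norm \<nu> = 1 \<Longrightarrow> cmod (zc \<nu> v) \<le> norm v"
  by (rule power2_le_imp_le) (simp_all add: norm_zc_tp[of \<nu> v])

lemma norm_tp_le: "norm \<nu> = 1 \<Longrightarrow> norm (tp \<nu> v) \<le> norm v"
  by (rule power2_le_imp_le) (simp_all add: norm_zc_tp[of \<nu> v])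

subsection \<open>Levi form and holomorphic part of a real quadratic form\<close>

definition levi :: "(complex ^ 'n \<Rightarrow> complex ^ 'n \<Rightarrow> real) \<Rightarrow> complex ^ 'n \<Rightarrow> complex ^ 'n \<Rightarrow> real" where
  "levi B v w = (B v w + B (\<i> *s v) (\<i> *s w)) / 2"

text \<open>The imaginary part is the one forced on the real part by complex linearity in each
  argument. For a Hessian, the real part on the diagonal is the pluriharmonic part of the
  second-order Taylor term.\<close>

definition hpart :: "(complex ^ 'n \<Rightarrow> complex ^ 'n \<Rightarrow> real) \<Rightarrow> complex ^ 'n \<Rightarrow> complex ^ 'n \<Rightarrow> complex" where
  "hpart B v w = Complex ((B v w - B (\<i> *s v) (\<i> *s w)) / 4) (- (B (\<i> *s v) w + B v (\<i> *s w)) / 4)"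

locale real_form =
  fixes B :: "complex ^ 'n \<Rightarrow> complex ^ 'n \<Rightarrow> real"
  assumes bilinear: "bounded_bilinear B" and symmetric: "B v w = B w v"
begin

sublocale B: bounded_bilinear B by (rule bilinear)

lemma form_decomp: "B v v = levi B v v + 2 * Re (hpart B v v)"
  by (simp add: levi_def hpart_def field_simps)

lemma hpart_I: "hpart B (\<i> *s v) w = \<i> * hpart B v w"
  by (simp add: hpart_def complex_eq_iff ii_smult B.minus_left B.minus_right field_simps)

lemma hpart_sym: "hpart B v w = hpart B w v"
  using symmetric[of v w] symmetric[of "\<i> *s v" w] symmetric[of v "\<i> *s w"]
    symmetric[of "\<i> *s v" "\<i> *s w"]
  by (simp add: hpart_def complex_eq_iff)

lemma linear_hpart: "linear (\<lambda>v. hpart B v w)"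
  by (rule linearI)
    (simp_all add: hpart_def complex_eq_iff B.add_left B.scaleR_left vector_add_ldistrib
      ii_scaleR field_simps)

lemma hpart_smult: "hpart B (c *s v) w = c * hpart B v w"
  by (subst complex_smult_eq)
    (simp add: linear_add[OF linear_hpart] linear_scale[OF linear_hpart] hpart_I complex_eq_iff)

lemma hpart_smult_self: "hpart B (c *s v) (c *s v) = c\<^sup>2 * hpart B v v"
  by (simp add: hpart_smult hpart_sym[of v "c *s v"] power2_eq_square)

lemma levi_I: "levi B (\<i> *s v) (\<i> *s w) = levi B v w"
  by (simp add: levi_def ii_smult B.minus_left B.minus_right)

lemma bounded_bilinear_hpart: "bounded_bilinear (hpart B)"
proof -
  have "hpart B v = (\<lambda>w. hpart B w v)" for v
    by (rule ext) (rule hpart_sym)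
  then have "linear (hpart B v)" for v
    using linear_hpart[of v] by metis
  with linear_hpart show ?thesis
    by (simp add: bilinear_conv_bounded_bilinear[symmetric] bilinear_def)
qed

lemma bounded_bilinear_levi: "bounded_bilinear (levi B)"
proof -
  have "linear (levi B v)" "linear (\<lambda>v. levi B v w)" for v w
    unfolding levi_def
    by (rule linearI; simp add: B.add_left B.add_right B.scaleR_left B.scaleR_right
        ii_scaleR vector_add_ldistrib field_simps)+
  then show ?thesis
    by (simp add: bilinear_conv_bounded_bilinear[symmetric] bilinear_def)
qed

lemma levi_sym: "levi B v w = levi B w v"
  by (simp add: levi_def symmetric[of v w] symmetric[of "\<i> *s v" "\<i> *s w"])

text \<open>Invariance under \<open>\<i>\<close> together with symmetry makes
  \<open>levi B v (\<i> *s v)\<close> its own negative, so the cross terms vanish.\<close>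

lemma levi_smult_self: "levi B (c *s v) (c *s v) = (cmod c)\<^sup>2 * levi B v v"
proof -
  interpret L: bounded_bilinear "levi B" by (rule bounded_bilinear_levi)
  have "levi B (\<i> *s v) v = - levi B v (\<i> *s v)"
    using levi_I[of "\<i> *s v" v] by (simp add: ii_smult L.minus_left)
  then have "levi B v (\<i> *s v) = 0" "levi B (\<i> *s v) v = 0"
    using levi_sym[of v "\<i> *s v"] by simp_all
  then show ?thesis
    by (subst (1 2) complex_smult_eq)
      (simp add: L.add_left L.add_right L.scaleR_left L.scaleR_right levi_I cmod_power2 mult.assoc[symmetric]
        power2_eq_square[symmetric] ring_distribs[symmetric])
qed

text \<open>Rotating \<open>v\<close> by a unit scalar \<open>u\<close> fixes the Levi form and multiplies the holomorphic part by
  \<open>u\<^sup>2\<close>, so positivity of the real form along the whole circle controls the modulus.\<close>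

lemma levi_minus_hpart:
  assumes "\<And>u. cmod u = 1 \<Longrightarrow> B (u *s v) (u *s v) \<ge> m"
  shows "levi B v v - 2 * cmod (hpart B v v) \<ge> m"
proof (cases "hpart B v v = 0")
  case True
  then show ?thesis using assms[of 1] form_decomp[of v] by simp
next
  case False
  let ?q = "hpart B v v"
  \<comment> \<open>The rotation for which the holomorphic part is most negative:
    \<open>u^2 * ?q\<close> equals \<open>- cmod ?q\<close>.\<close>
  define u where "u = csqrt (- cnj ?q / cmod ?q)"
  have u2: "u\<^sup>2 = - cnj ?q / cmod ?q" by (simp add: u_def)
  have "(cmod u)\<^sup>2 = 1"
    using False by (simp add: norm_power[symmetric] u2 norm_divide)
  then have u: "cmod u = 1" by (simp add: power2_eq_1_iff) (smt (verit) norm_ge_zero)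
  have "u\<^sup>2 * ?q = - of_real ((cmod ?q)\<^sup>2 / cmod ?q)"
    by (simp add: u2 complex_norm_square[symmetric] mult.commute[of "cnj _"] del: of_real_power)
  also have "\<dots> = - of_real (cmod ?q)" using False by (simp add: power2_eq_square)
  finally have "Re (u\<^sup>2 * ?q) = - cmod ?q" by simp
  then show ?thesis
    using assms[OF u] form_decomp[of "u *s v"] u
    by (simp add: hpart_smult_self levi_smult_self)
qed

end

subsection \<open>Complex differentiability\<close>

text \<open>Scalar counterpart of \<open>holo_on\<close>: a real derivative commuting with
  \<open>\<i>\<close>, so that the rules for \<open>has_derivative\<close> carry over.\<close>

definition cdiff_at :: "(complex ^ 'n \<Rightarrow> complex) \<Rightarrow> complex ^ 'n \<Rightarrow> bool" where
  "cdiff_at f z \<longleftrightarrow> (\<exists>D. (f has_derivative D) (at z) \<and> (\<forall>v. D (\<i> *s v) = \<i> * D v))"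

lemma cdiff_const: "cdiff_at (\<lambda>_. c) z"
  unfolding cdiff_at_def by (rule exI[of _ "\<lambda>_. 0"]) simp

lemma cdiff_add: "cdiff_at f z \<Longrightarrow> cdiff_at g z \<Longrightarrow> cdiff_at (\<lambda>x. f x + g x) z"
  unfolding cdiff_at_def
  by (elim exE conjE, rule exI, rule conjI, erule (1) has_derivative_add) (simp add: ring_distribs)

lemma cdiff_mult: "cdiff_at f z \<Longrightarrow> cdiff_at g z \<Longrightarrow> cdiff_at (\<lambda>x. f x * g x) z"
  unfolding cdiff_at_def
  by (elim exE conjE, rule exI, rule conjI, erule (1) has_derivative_mult) (simp add: algebra_simps)

lemma cdiff_minus: "cdiff_at f z \<Longrightarrow> cdiff_at g z \<Longrightarrow> cdiff_at (\<lambda>x. f x - g x) z"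
  using cdiff_add[of f z "\<lambda>x. (-1) * g x"] cdiff_mult[OF cdiff_const[of "-1"], of g z] by simp

lemma cdiff_inverse:
  assumes "cdiff_at f z" "f z \<noteq> 0"
  shows "cdiff_at (\<lambda>x. inverse (f x)) z"
proof -
  obtain D where D: "(f has_derivative D) (at z)" "\<And>v. D (\<i> *s v) = \<i> * D v"
    using assms(1) by (auto simp: cdiff_at_def)
  show ?thesis
    unfolding cdiff_at_def
    by (rule exI, rule conjI, rule Deriv.has_derivative_inverse[OF assms(2) D(1)]) (simp add: D(2))
qed

lemma cdiff_divide: "cdiff_at f z \<Longrightarrow> cdiff_at g z \<Longrightarrow> g z \<noteq> 0 \<Longrightarrow> cdiff_at (\<lambda>x. f x / g x) z"
  using cdiff_mult[of f z "\<lambda>x. inverse (g x)"] cdiff_inverse[of g z]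
  by (simp add: divide_inverse)

lemma cdiff_zc: "cdiff_at (\<lambda>x. zc \<nu> (x - a)) z"
  unfolding cdiff_at_def
proof (intro exI conjI allI)
  have "((zc \<nu> \<circ> (\<lambda>x. x - a)) has_derivative (zc \<nu> \<circ> (\<lambda>x. x))) (at z)"
    by (rule diff_chain_at) (auto intro!: derivative_eq_intros linear_imp_has_derivative linear_zc)
  then show "((\<lambda>x. zc \<nu> (x - a)) has_derivative zc \<nu>) (at z)" by (simp add: o_def)
qed (simp add: zc_smult)

lemma has_derivative_tp: "((\<lambda>x. tp \<nu> (x - a)) has_derivative tp \<nu>) (at z)"
proof -
  have "((tp \<nu> \<circ> (\<lambda>x. x - a)) has_derivative (tp \<nu> \<circ> (\<lambda>x. x))) (at z)"
    by (rule diff_chain_at) (auto intro!: derivative_eq_intros linear_imp_has_derivative linear_tp)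
  then show ?thesis by (simp add: o_def)
qed

lemma (in real_form) cdiff_hpart: "cdiff_at (\<lambda>x. hpart B (tp \<nu> (x - a)) (tp \<nu> (x - a))) z"
  unfolding cdiff_at_def
  by (rule exI, rule conjI,
      rule bounded_bilinear.FDERIV[OF bounded_bilinear_hpart has_derivative_tp has_derivative_tp])
    (simp add: tp_smult hpart_I hpart_sym[of "tp \<nu> (z - a)"] ring_distribs)

text \<open>This is the shape of the Cayley map followed by a linear change of coordinates;
  holomorphy is reduced to the two scalar coefficients.\<close>

lemma holo_on_smult_linear:
  fixes T :: "complex ^ 'n \<Rightarrow> complex ^ 'n"
  assumes T: "linear T" "\<And>v. T (\<i> *s v) = \<i> *s T v"
    and a: "\<And>z. z \<in> S \<Longrightarrow> cdiff_at \<alpha> z" and b: "\<And>z. z \<in> S \<Longrightarrow> cdiff_at \<beta> z"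
  shows "holo_on (\<lambda>x. T (\<alpha> x *s \<nu> + \<beta> x *s tp \<nu> (x - a))) S"
  unfolding holo_on_def
proof
  fix z assume z: "z \<in> S"
  obtain D1 where D1: "(\<alpha> has_derivative D1) (at z)" "\<And>v. D1 (\<i> *s v) = \<i> * D1 v"
    using a[OF z] by (auto simp: cdiff_at_def)
  obtain D2 where D2: "(\<beta> has_derivative D2) (at z)" "\<And>v. D2 (\<i> *s v) = \<i> * D2 v"
    using b[OF z] by (auto simp: cdiff_at_def)
  let ?D = "\<lambda>v. D1 v *s \<nu> + (\<beta> z *s tp \<nu> v + D2 v *s tp \<nu> (z - a))"
  have "((\<lambda>x. \<alpha> x *s \<nu> + \<beta> x *s tp \<nu> (x - a)) has_derivative ?D) (at z)"
    using bounded_bilinear.FDERIV[OF bounded_bilinear_smult D1(1) has_derivative_const[of \<nu>]]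
      bounded_bilinear.FDERIV[OF bounded_bilinear_smult D2(1) has_derivative_tp]
    by (intro has_derivative_add) simp_all
  from diff_chain_at[OF this linear_imp_has_derivative[OF T(1)]]
  have "((\<lambda>x. T (\<alpha> x *s \<nu> + \<beta> x *s tp \<nu> (x - a))) has_derivative (\<lambda>v. T (?D v))) (at z)"
    by (simp add: o_def)
  moreover have "T (?D (\<i> *s v)) = \<i> *s T (?D v)" for v
    by (simp flip: T(2) add: D1 D2 tp_smult vec_eq_iff algebra_simps)
  ultimately show "\<exists>D. ((\<lambda>x. T (\<alpha> x *s \<nu> + \<beta> x *s tp \<nu> (x - a))) has_derivative D) (at z) \<and>
      (\<forall>v. D (\<i> *s v) = \<i> *s D v)" by blast
qed

subsection \<open>The squeezing function\<close>

lemma squeezing_radius_le_1: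
  fixes p :: "complex ^ 'n"
  assumes "r \<in> {r. r > 0 \<and> (\<exists>f\<in>squeeze_maps p \<Omega>. ball 0 r \<subseteq> f ` \<Omega>)}"
  shows "r \<le> 1"
proof -
  from assms have "ball (0 :: complex ^ 'n) r \<subseteq> ball 0 1" "r > 0"
    unfolding squeeze_maps_def by blast+
  then show "r \<le> 1" by (simp add: ball_subset_ball_iff)
qed

text \<open>Dividing \<open>F\<close> by \<open>A\<close> gives a competitor. It also shows that the
  set of radii is nonempty, which the upper bound on the real supremum relies on.\<close>

lemma squeezing_between:
  fixes F :: "complex ^ 'n \<Rightarrow> complex ^ 'n"
  assumes inj: "inj_on F \<Omega>" and holo: "holo_on F \<Omega>" and "F p = 0"
    and bound: "\<And>z. z \<in> \<Omega> \<Longrightarrow> norm (F z) < A" and onto: "ball 0 a \<subseteq> F ` \<Omega>"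
    and "0 < a" "0 < A"
  shows "a / A \<le> squeezing \<Omega> p" "squeezing \<Omega> p \<le> 1"
proof -
  let ?R = "{r. r > 0 \<and> (\<exists>f\<in>squeeze_maps p \<Omega>. ball 0 r \<subseteq> f ` \<Omega>)}"
  define f where "f z = (1 / A) *\<^sub>R F z" for z
  have "inj_on f \<Omega>" using inj \<open>0 < A\<close> by (simp add: f_def inj_on_def)
  moreover have "holo_on f \<Omega>"
    unfolding holo_on_def
  proof
    fix z assume "z \<in> \<Omega>"
    then obtain D where D: "(F has_derivative D) (at z)" "\<And>v. D (\<i> *s v) = \<i> *s D v"
      using holo unfolding holo_on_def by blast
    have "(f has_derivative (\<lambda>v. (1 / A) *\<^sub>R D v)) (at z)"
      unfolding f_def by (rule has_derivative_scaleR_right[OF D(1)])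
    then show "\<exists>D. (f has_derivative D) (at z) \<and> (\<forall>v. D (\<i> *s v) = \<i> *s D v)"
      by (intro exI[of _ "\<lambda>v. (1 / A) *\<^sub>R D v"]) (simp only: D(2) ii_scaleR, simp)
  qed
  moreover have "f ` \<Omega> \<subseteq> ball 0 1"
    using bound \<open>0 < A\<close> by (auto simp: f_def)
  ultimately have "f \<in> squeeze_maps p \<Omega>"
    using \<open>F p = 0\<close> by (simp add: squeeze_maps_def f_def)
  moreover have "ball 0 (a / A) \<subseteq> f ` \<Omega>"
  proof
    fix w :: "complex ^ 'n" assume "w \<in> ball 0 (a / A)"
    then have "A *\<^sub>R w \<in> ball 0 a" using \<open>0 < A\<close> by (simp add: field_simps)
    then obtain z where "z \<in> \<Omega>" "F z = A *\<^sub>R w" using onto by (metis (no_types) imageE subsetD)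
    then show "w \<in> f ` \<Omega>" using \<open>0 < A\<close> by (intro image_eqI[of _ _ z]) (simp_all add: f_def)
  qed
  ultimately have mem: "a / A \<in> ?R" using \<open>0 < a\<close> \<open>0 < A\<close> by auto
  have "bdd_above ?R" by (rule bdd_aboveI[of _ 1]) (rule squeezing_radius_le_1)
  with mem show "a / A \<le> squeezing \<Omega> p"
    unfolding squeezing_def by (rule cSup_upper)
  show "squeezing \<Omega> p \<le> 1"
    unfolding squeezing_def
    by (rule cSup_least) (use mem squeezing_radius_le_1 in blast)+
qed

subsection \<open>The map attached to a boundary point\<close>

text \<open>All constants are independent of the boundary point \<open>x\<close>; the function \<open>r\<close> is a modulus:
  within distance \<open>r \<eta>\<close> of \<open>x\<close>, the domain is the paraboloid of its second-order
  Taylor expansion up to \<open>\<eta>\<close>. Here \<open>\<nu>\<close> is the inner normal.\<close>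

locale boundary_model = real_form B for B :: "complex ^ 'n \<Rightarrow> complex ^ 'n \<Rightarrow> real" +
  fixes \<kappa> c M D :: real and r :: "real \<Rightarrow> real" and \<Omega> :: "(complex ^ 'n) set" and x \<nu> :: "complex ^ 'n"
  assumes const_pos: "0 < \<kappa>" "0 < c" "1 \<le> M" "0 < D" and r_pos: "0 < \<eta> \<Longrightarrow> 0 < r \<eta>"
    and nu: "norm \<nu> = 1"
    and B_pos: "zc \<nu> v = 0 \<Longrightarrow> c * (norm v)\<^sup>2 \<le> B v v"
    and B_le: "\<bar>B v w\<bar> \<le> M * norm v * norm w"
    and size: "x + v \<in> \<Omega> \<Longrightarrow> norm v \<le> D"
    and support: "x + v \<in> \<Omega> \<Longrightarrow> \<kappa> * (norm v)\<^sup>2 \<le> Re (zc \<nu> v)"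
    and outside: "x \<notin> \<Omega>"
    and taylor_upper: "0 < \<eta> \<Longrightarrow> norm v < r \<eta> \<Longrightarrow> x + v \<in> \<Omega> \<Longrightarrow>
      B (tp \<nu> v) (tp \<nu> v) - \<eta> * (cmod (zc \<nu> v) + (norm (tp \<nu> v))\<^sup>2) \<le> 2 * Re (zc \<nu> v)"
    and taylor_lower: "0 < \<eta> \<Longrightarrow> norm v < r \<eta> \<Longrightarrow>
      B (tp \<nu> v) (tp \<nu> v) + \<eta> * (cmod (zc \<nu> v) + (norm (tp \<nu> v))\<^sup>2) < 2 * Re (zc \<nu> v) \<Longrightarrow> x + v \<in> \<Omega>"
begin

abbreviation "L v \<equiv> levi B (tp \<nu> v) (tp \<nu> v)"
abbreviation "q v \<equiv> hpart B (tp \<nu> v) (tp \<nu> v)"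
abbreviation "\<zeta> v \<equiv> zc \<nu> v"

section \<open>Basic estimates at a boundary point\<close>

lemma c_pos: "0 < c" and M_ge: "1 \<le> M" and kappa_pos: "0 < \<kappa>"
  using const_pos by auto

text \<open>The complex tangent space is stable under unit scalars, so \<open>B\<close> is bounded
  below along the whole circle through \<open>tp \<nu> v\<close>.\<close>

lemma levi_q: "c * (norm (tp \<nu> v))\<^sup>2 \<le> L v - 2 * cmod (q v)"
proof (rule levi_minus_hpart)
  fix u :: complex assume u: "cmod u = 1"
  have "zc \<nu> (u *s tp \<nu> v) = 0" using zc_tp[OF nu] by (simp add: zc_smult)
  from B_pos[OF this] u show "c * (norm (tp \<nu> v))\<^sup>2 \<le> B (u *s tp \<nu> v) (u *s tp \<nu> v)"
    by (simp add: norm_vector_smult)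
qed

lemma levi_ge: "c * (norm (tp \<nu> v))\<^sup>2 \<le> L v"
  using levi_q[of v] norm_ge_zero[of "q v"] by linarith

lemma levi_nonneg: "0 \<le> L v"
  using levi_ge[of v] c_pos by (meson order_trans mult_nonneg_nonneg zero_le_power2 less_imp_le)

lemma levi_le: "L v \<le> M * (norm (tp \<nu> v))\<^sup>2"
  using B_le[of "tp \<nu> v" "tp \<nu> v"] B_le[of "\<i> *s tp \<nu> v" "\<i> *s tp \<nu> v"]
  by (simp add: levi_def norm_vector_smult power2_eq_square)

lemma q_le: "cmod (q v) \<le> M * (norm (tp \<nu> v))\<^sup>2"
  using levi_q[of v] levi_le[of v] c_pos norm_ge_zero[of "q v"]
  by (smt (verit, best) mult_nonneg_nonneg zero_le_power2)

lemma B_eq: "B (tp \<nu> v) (tp \<nu> v) = L v + 2 * Re (q v)"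
  by (rule form_decomp)

lemma Re_zc_pos: "x + v \<in> \<Omega> \<Longrightarrow> 0 < Re (\<zeta> v)"
  using support[of v] outside kappa_pos
  by (cases "v = 0") (auto intro: less_le_trans[rotated] mult_pos_pos)

text \<open>Localization: a point of the domain with small \<open>\<zeta>\<close> is close to
  \<open>x\<close>.\<close>

lemma norm_sq_le: "x + v \<in> \<Omega> \<Longrightarrow> \<kappa> * (norm v)\<^sup>2 \<le> cmod (\<zeta> v)"
  using support[of v] complex_Re_le_cmod[of "\<zeta> v"] by linarith

lemma tp_sq_le: "(norm (tp \<nu> v))\<^sup>2 \<le> (norm v)\<^sup>2"
  using norm_tp_le[OF nu, of v] by (simp add: power_mono)

text \<open>The shear by \<open>q\<close> removes the pluriharmonic part of the defining function; the term
  \<open>K * \<zeta>\<^sup>2\<close> has higher weight at \<open>x\<close>, and it keeps \<open>shear K\<close> away from zero on the part of the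
  domain far from \<open>x\<close>.\<close>

definition shear :: "real \<Rightarrow> complex ^ 'n \<Rightarrow> complex" where
  "shear K v = \<zeta> v + of_real K * (\<zeta> v)\<^sup>2 - q v"

text \<open>The constant left by the absorption argument near \<open>x\<close> in
  \<open>shear_ge\<close>; it is independent of \<open>K\<close>.\<close>

definition c' :: real where "c' = c / (2 * (c + 4 * M))"

lemma c'_pos: "0 < c'" and c'_le: "c' \<le> 1"
  using c_pos M_ge by (simp_all add: c'_def field_simps)

text \<open>Within \<open>r \<eta>\<close> of \<open>x\<close>, the Taylor expansion and the
  dominance of the Levi form over \<open>q\<close> give the bound. Farther away
  \<open>cmod (\<zeta> v)\<close> is at least \<open>s\<close>, and the choice of \<open>K\<close>
  lets the quadratic term outweigh \<open>q\<close>.\<close>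

lemma shear_ge:
  assumes v: "x + v \<in> \<Omega>" and eta: "0 < \<eta>" "\<eta> \<le> c / (4 * M)"
    and s: "s = \<kappa> * (r \<eta>)\<^sup>2" and K: "1 + M * D\<^sup>2 / s \<le> K * s" "0 < K"
  shows "c' * cmod (\<zeta> v) \<le> cmod (shear K v)"
proof (cases "norm v < r \<eta>")
  case True
  let ?z = "\<zeta> v" and ?q = "q v" and ?n = "(norm (tp \<nu> v))\<^sup>2"
  \<comment> \<open>Dividing the shear by \<open>w\<close>, whose modulus is at least 1, removes
    \<open>K\<close> from the rest of the estimate.\<close>
  define w where "w = 1 + of_real K * ?z"
  have Rez: "0 < Re ?z" by (rule Re_zc_pos[OF v])
  then have Rew: "1 < Re w" using K(2) by (simp add: w_def)
  then have w0: "w \<noteq> 0" by auto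
  have w1: "1 \<le> cmod w" using Rew complex_Re_le_cmod[of w] by linarith
  define X where "X = cmod (?z - ?q / w)"
  have "shear K v = w * (?z - ?q / w)"
    using w0 by (simp add: shear_def w_def field_simps power2_eq_square)
  then have hX: "X \<le> cmod (shear K v)"
    using w1 mult_right_mono[of 1 "cmod w" X] by (simp add: X_def norm_mult)
  \<comment> \<open>Replacing \<open>q\<close> by \<open>q / w\<close> lowers the real part by at
    most \<open>cmod q\<close>, precisely the loss that \<open>levi_q\<close> can pay for.\<close>
  have "cmod (w - 1) \<le> cmod w"
    using Rew by (simp add: cmod_def power2_eq_square algebra_simps)
  then have "cmod (?q * ((w - 1) / w)) \<le> cmod ?q"
    using w0 by (simp add: norm_mult norm_divide divide_le_eq mult_left_mono)
  then have "- cmod ?q \<le> Re (?q * ((w - 1) / w))"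
    using abs_Re_le_cmod[of "?q * ((w - 1) / w)"] by linarith
  also have "?q * ((w - 1) / w) = ?q - ?q / w" using w0 by (simp add: field_simps)
  finally have Req: "- cmod ?q \<le> Re ?q - Re (?q / w)" by simp
  have "L v + 2 * Re ?q - \<eta> * (cmod ?z + ?n) \<le> 2 * Re ?z"
    using taylor_upper[OF eta(1) True v] B_eq[of v] by simp
  moreover have "Re (?z - ?q / w) \<le> X" unfolding X_def by (rule complex_Re_le_cmod)
  ultimately have 1: "c * ?n - \<eta> * (cmod ?z + ?n) \<le> 2 * X"
    using levi_q[of v] Req by simp
  have "4 * \<eta> * 1 \<le> 4 * \<eta> * M" using M_ge eta(1) by (intro mult_left_mono) auto
  also have "\<dots> \<le> c" using eta(2) M_ge by (simp add: field_simps)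
  finally have "\<eta> * ?n \<le> c / 2 * ?n" using eta(1) by (intro mult_right_mono) auto
  with 1 have 2: "c / 2 * ?n \<le> 2 * X + \<eta> * cmod ?z" by (simp add: algebra_simps)
  have "cmod (?q / w) \<le> cmod ?q" using w1 w0 by (simp add: norm_divide divide_le_eq mult_left_le_one_le mult_le_cancel_left1)
  then have "cmod ?z \<le> X + M * ?n"
    using norm_triangle_ineq[of "?z - ?q / w" "?q / w"] q_le[of v] by (simp add: X_def)
  then have "c * cmod ?z \<le> c * X + M * (c * ?n)"
    using c_pos mult_left_mono[of "cmod ?z" "X + M * ?n" c] by (simp add: algebra_simps)
  also have "M * (c * ?n) \<le> M * (4 * X + 2 * \<eta> * cmod ?z)"
    using 2 M_ge by (intro mult_left_mono) auto
  finally have 3: "c * cmod ?z \<le> (c + 4 * M) * X + (2 * M * \<eta>) * cmod ?z"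
    by (simp add: algebra_simps)
  \<comment> \<open>The bound on \<open>\<eta>\<close> is made for this absorption of half of
    \<open>c * cmod ?z\<close>.\<close>
  have "2 * M * \<eta> \<le> c / 2" using eta M_ge by (simp add: field_simps)
  then have "(2 * M * \<eta>) * cmod ?z \<le> c / 2 * cmod ?z" by (intro mult_right_mono) auto
  with 3 have "c / 2 * cmod ?z \<le> (c + 4 * M) * X" by simp
  then have "c' * cmod ?z \<le> X" using c_pos M_ge by (simp add: c'_def field_simps)
  with hX show ?thesis by linarith
next
  case False
  let ?z = "\<zeta> v"
  have s0: "0 < s" using r_pos[OF eta(1)] kappa_pos by (simp add: s)
  have Rez: "0 < Re ?z" by (rule Re_zc_pos[OF v])
  have "(r \<eta>)\<^sup>2 \<le> (norm v)\<^sup>2" using False r_pos[OF eta(1)] by (intro power_mono) auto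
  then have sz: "s \<le> cmod ?z" using norm_sq_le[OF v] kappa_pos unfolding s
    by (meson order_trans mult_left_mono less_imp_le)
  have "cmod (of_real K * ?z) \<le> cmod (1 + of_real K * ?z)"
    using Rez K(2) by (simp add: cmod_def power2_eq_square algebra_simps)
  then have "K * cmod ?z \<le> cmod (1 + of_real K * ?z)" using K(2) by (simp add: norm_mult)
  then have "cmod ?z * (K * cmod ?z) \<le> cmod (?z * (1 + of_real K * ?z))"
    by (simp add: norm_mult mult_left_mono)
  moreover have "cmod ?z * (K * s) \<le> cmod ?z * (K * cmod ?z)"
    using sz K(2) by (intro mult_left_mono) auto
  \<comment> \<open>Of the two terms bounding \<open>K * s\<close>, the 1 yields
    \<open>cmod ?z\<close> itself, and \<open>M * D^2 / s\<close> compensates \<open>q\<close>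
    because \<open>cmod ?z\<close> is at least \<open>s\<close>.\<close>
  moreover have "cmod ?z * (1 + M * D\<^sup>2 / s) \<le> cmod ?z * (K * s)"
    using K(1) by (intro mult_left_mono) auto
  moreover have "M * D\<^sup>2 / s * s \<le> M * D\<^sup>2 / s * cmod ?z"
    using sz s0 M_ge by (intro mult_left_mono) auto
  moreover have "cmod (q v) \<le> M * D\<^sup>2"
  proof -
    have "(norm v)\<^sup>2 \<le> D\<^sup>2" using size[OF v] by (intro power_mono) auto
    then have "M * (norm (tp \<nu> v))\<^sup>2 \<le> M * D\<^sup>2"
      using M_ge by (intro mult_left_mono order_trans[OF tp_sq_le]) auto
    then show ?thesis using q_le[of v] by linarith
  qed
  moreover have "cmod (?z * (1 + of_real K * ?z)) \<le> cmod (shear K v) + cmod (q v)"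
    using norm_triangle_ineq[of "shear K v" "q v"]
    by (simp add: shear_def algebra_simps power2_eq_square)
  ultimately have "cmod ?z \<le> cmod (shear K v)"
    using s0 by (simp add: algebra_simps)
  then show ?thesis using c'_le c'_pos mult_right_mono[of c' 1 "cmod ?z"] by simp
qed

text \<open>Up to a linear change of coordinates, \<open>qnorm\<close> is the squared Euclidean norm of the image ball, and
  \<open>qnorm (cayley K t v) < 1\<close> means \<open>L v < 2 Re (shear K v)\<close>.\<close>

definition qnorm :: "complex ^ 'n \<Rightarrow> real" where
  "qnorm w = (cmod (\<zeta> w))\<^sup>2 + 2 * L w"

definition cayley :: "real \<Rightarrow> real \<Rightarrow> complex ^ 'n \<Rightarrow> complex ^ 'n" where
  "cayley K t v = ((of_real t - shear K v) / (of_real t + shear K v)) *s \<nu>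
     + (of_real (sqrt t) / (of_real t + shear K v)) *s tp \<nu> v"

lemma zc_cayley: "\<zeta> (cayley K t v) = (of_real t - shear K v) / (of_real t + shear K v)"
  and tp_cayley: "tp \<nu> (cayley K t v) = (of_real (sqrt t) / (of_real t + shear K v)) *s tp \<nu> v"
  unfolding cayley_def by (simp_all add: zc_tp_parts[OF nu] zc_smult zc_tp[OF nu])

text \<open>The identity \<open>|t - h|^2 = |t + h|^2 - 4 t Re h\<close> for real \<open>t\<close>.
  Both inclusions for the image thereby become estimates of
  \<open>2 * Re (shear K v) - L v\<close>.\<close>

lemma qnorm_cayley:
  assumes "0 < t" "of_real t + shear K v \<noteq> 0"
  shows "qnorm (cayley K t v) = 1 - 2 * t * (2 * Re (shear K v) - L v) / (cmod (of_real t + shear K v))\<^sup>2"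
proof -
  let ?h = "shear K v"
  let ?d = "(cmod (of_real t + ?h))\<^sup>2"
  have d: "?d \<noteq> 0" using assms by simp
  have "qnorm (cayley K t v) = (cmod (of_real t - ?h))\<^sup>2 / ?d + 2 * (t / ?d * L v)"
    using assms by (simp add: qnorm_def zc_cayley tp_cayley levi_smult_self norm_divide power_divide)
  also have "(cmod (of_real t - ?h))\<^sup>2 = ?d - 4 * t * Re ?h"
    unfolding cmod_power2 by (simp add: power2_eq_square algebra_simps)
  finally show ?thesis using d by (simp add: field_simps)
qed

text \<open>Only a negative \<open>2 * Re (shear K v) - L v\<close> can push \<open>qnorm\<close>
  above 1. If \<open>cmod (\<zeta> v)\<close> is at least \<open>R * t\<close>, the denominator is
  large compared with \<open>t\<close>; otherwise the Taylor expansion bounds the defect by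
  \<open>\<tau> * t\<close>.\<close>

lemma cayley_bound:
  assumes v: "x + v \<in> \<Omega>" and low: "c' * cmod (\<zeta> v) \<le> cmod (shear K v)" and "0 < K"
    and tau: "0 < \<tau>" "\<tau> \<le> 1" and R: "R = (2 + M / (\<kappa> * c')) / (c' * \<tau>)"
    and eta: "\<eta> = \<tau> / (2 * R * (1 + 1 / \<kappa>))"
    and t: "0 < t" "t \<le> \<tau> / (4 * K * R\<^sup>2)" "R * t < \<kappa> * (r \<eta>)\<^sup>2"
  shows "of_real t + shear K v \<noteq> 0" "qnorm (cayley K t v) \<le> 1 + 8 * \<tau>"
proof -
  let ?z = "\<zeta> v" and ?h = "shear K v" and ?n = "(norm (tp \<nu> v))\<^sup>2"
  let ?d = "cmod (of_real t + ?h)"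
  note pos = c'_pos kappa_pos c_pos M_ge
  have R0: "0 < R" using pos tau by (simp add: R add_pos_nonneg)
  have zn: "\<kappa> * ?n \<le> cmod ?z"
    using tp_sq_le[of v] kappa_pos norm_sq_le[OF v] by (meson order_trans mult_left_mono less_imp_le)
  have "of_real t + ?h \<noteq> 0 \<and> - (2 * t * (2 * Re ?h - L v)) \<le> 8 * \<tau> * ?d\<^sup>2"
  proof (cases "R * t \<le> cmod ?z")
    case True
    \<comment> \<open>The definition of \<open>R\<close> is read off here: the right side bounds the
      defect relative to \<open>cmod ?h\<close>, while \<open>c' * R\<close> being at least 2 keeps
      \<open>?d\<close> above half of \<open>cmod ?h\<close>.\<close>
    have Rc: "c' * R * \<tau> = 2 + M / (\<kappa> * c')" using pos tau by (simp add: R)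
    have "c' * R * \<tau> \<le> c' * R" using pos tau R0 by (simp add: mult_left_le)
    moreover have "0 \<le> M / (\<kappa> * c')" using pos by simp
    ultimately have Rc2: "2 \<le> c' * R" using Rc by linarith
    have h1: "c' * R * t \<le> cmod ?h"
      using mult_left_mono[OF True less_imp_le[OF c'_pos]] low by (simp add: mult.assoc)
    have "2 * t \<le> c' * R * t" using Rc2 t(1) by (intro mult_right_mono) auto
    with h1 have h2: "2 * t \<le> cmod ?h" by linarith
    have h0: "0 < cmod ?h" using h2 t(1) by linarith
    have "cmod ?h \<le> ?d + t" using norm_triangle_ineq4[of "of_real t + ?h" "of_real t"] t(1) by simp
    with h2 have d: "cmod ?h \<le> 2 * ?d" by linarith
    have n: "L v \<le> M / (\<kappa> * c') * cmod ?h"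
    proof -
      have "\<kappa> * c' * ?n \<le> cmod ?h"
        using mult_left_mono[OF zn less_imp_le[OF c'_pos]] low by (simp add: algebra_simps)
      then have "M * ?n \<le> M / (\<kappa> * c') * cmod ?h"
        using pos by (simp add: field_simps)
      then show ?thesis using levi_le[of v] by linarith
    qed
    have "- (2 * Re ?h - L v) \<le> 2 * cmod ?h + L v"
      using abs_Re_le_cmod[of ?h] levi_nonneg[of v] by linarith
    also have "\<dots> \<le> c' * R * \<tau> * cmod ?h" using n unfolding Rc by (simp add: algebra_simps)
    finally have "2 * t * - (2 * Re ?h - L v) \<le> 2 * t * (c' * R * \<tau> * cmod ?h)"
      using t(1) by (intro mult_left_mono) auto
    also have "\<dots> = 2 * \<tau> * cmod ?h * (c' * R * t)" by simp
    also have "\<dots> \<le> 2 * \<tau> * cmod ?h * cmod ?h" using h1 tau by (intro mult_left_mono) auto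
    also have "\<dots> = 2 * \<tau> * (cmod ?h)\<^sup>2" by (simp add: power2_eq_square)
    also have "\<dots> \<le> 2 * \<tau> * (2 * ?d)\<^sup>2" using d tau by (intro mult_left_mono power_mono) auto
    finally have "- (2 * t * (2 * Re ?h - L v)) \<le> 8 * \<tau> * ?d\<^sup>2" by (simp add: power2_eq_square algebra_simps)
    moreover have "of_real t + ?h \<noteq> 0" using d h0 by auto
    ultimately show ?thesis by blast
  next
    case False
    have eta0: "0 < \<eta>" using tau R0 kappa_pos by (simp add: eta add_pos_pos)
    have "\<kappa> * (norm v)\<^sup>2 < \<kappa> * (r \<eta>)\<^sup>2" using norm_sq_le[OF v] False t(3) by linarith
    then have "norm v < r \<eta>"
      using kappa_pos r_pos[OF eta0] by (auto dest: power_less_imp_less_base)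
    from taylor_upper[OF eta0 this v]
    have T: "L v + 2 * Re (q v) - \<eta> * (cmod ?z + ?n) \<le> 2 * Re ?z" by (simp add: B_eq)
    have "?n \<le> cmod ?z / \<kappa>" using zn kappa_pos by (simp add: field_simps)
    \<comment> \<open>The Taylor error and the term from \<open>K\<close> are each allowed
      \<open>\<tau> * t / 2\<close>; this determines \<open>\<eta>\<close> and the first bound on
      \<open>t\<close>.\<close>
    then have "cmod ?z + ?n \<le> (1 + 1 / \<kappa>) * cmod ?z" by (simp add: algebra_simps)
    also have "\<dots> \<le> (1 + 1 / \<kappa>) * (R * t)" using False kappa_pos by (intro mult_left_mono) auto
    finally have "\<eta> * (cmod ?z + ?n) \<le> \<eta> * ((1 + 1 / \<kappa>) * (R * t))"
      using eta0 by (intro mult_left_mono) auto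
    also have "\<dots> = \<tau> * t / 2"
      using R0 kappa_pos unfolding eta by (simp add: add_pos_pos[THEN less_imp_neq, symmetric])
    finally have T1: "\<eta> * (cmod ?z + ?n) \<le> \<tau> * t / 2" .
    have "- Re (?z\<^sup>2) \<le> (cmod ?z)\<^sup>2" using abs_Re_le_cmod[of "?z\<^sup>2"] by (simp add: norm_power)
    also have "\<dots> \<le> (R * t)\<^sup>2" using False by (intro power_mono) auto
    finally have "2 * K * - Re (?z\<^sup>2) \<le> 2 * K * (R * t)\<^sup>2" using \<open>0 < K\<close> by (intro mult_left_mono) auto
    also have "\<dots> = 2 * K * R\<^sup>2 * t * t" by (simp add: power2_eq_square)
    also have "\<dots> \<le> 2 * K * R\<^sup>2 * (\<tau> / (4 * K * R\<^sup>2)) * t"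
      using t \<open>0 < K\<close> by (intro mult_right_mono mult_left_mono) auto
    also have "\<dots> = \<tau> * t / 2" using \<open>0 < K\<close> R0 by simp
    finally have T2: "2 * K * - Re (?z\<^sup>2) \<le> \<tau> * t / 2" .
    have E: "- (\<tau> * t) \<le> 2 * Re ?h - L v"
      using T T1 T2 by (simp add: shear_def)
    have "\<tau> * t \<le> t" using tau t by (simp add: mult_left_le_one_le)
    then have "t / 2 \<le> Re (of_real t + ?h)" using E levi_nonneg[of v] by simp
    then have d: "t / 2 \<le> ?d" using complex_Re_le_cmod[of "of_real t + ?h"] by linarith
    have "2 * t * - (2 * Re ?h - L v) \<le> 2 * t * (\<tau> * t)"
      using E t(1) by (intro mult_left_mono) auto
    then have "- (2 * t * (2 * Re ?h - L v)) \<le> 2 * t * (\<tau> * t)" by (simp only: mult_minus_right)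
    also have "\<dots> = 8 * \<tau> * (t / 2)\<^sup>2" by (simp add: power2_eq_square)
    also have "\<dots> \<le> 8 * \<tau> * ?d\<^sup>2" using d t tau by (intro mult_left_mono power_mono) auto
    finally show ?thesis using d t(1) by auto
  qed
  then have nz: "of_real t + ?h \<noteq> 0" and b: "- (2 * t * (2 * Re ?h - L v)) \<le> 8 * \<tau> * ?d\<^sup>2" by auto
  show "of_real t + ?h \<noteq> 0" by (rule nz)
  have "- (2 * t * (2 * Re ?h - L v)) / ?d\<^sup>2 \<le> 8 * \<tau>"
    by (subst pos_divide_le_eq) (use nz b in auto)
  then have "- (2 * t * (2 * Re ?h - L v) / ?d\<^sup>2) \<le> 8 * \<tau>"
    by (simp only: minus_divide_left)
  then show "qnorm (cayley K t v) \<le> 1 + 8 * \<tau>"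
    unfolding qnorm_cayley[OF t(1) nz] by linarith
qed

text \<open>The two components determine the shear and the tangential part. Equal shears then factor
  through \<open>1 + K (\<zeta> v + \<zeta> v')\<close>, which has positive real part because both
  points lie in the supporting half-space.\<close>

lemma cayley_inj:
  assumes "x + v \<in> \<Omega>" "x + v' \<in> \<Omega>" and K: "0 < K" and t: "0 < t"
    and nz: "of_real t + shear K v \<noteq> 0" "of_real t + shear K v' \<noteq> 0"
    and eq: "cayley K t v = cayley K t v'"
  shows "v = v'"
proof -
  have "(of_real t - shear K v) / (of_real t + shear K v)
      = (of_real t - shear K v') / (of_real t + shear K v')"
    using arg_cong[OF eq, of "zc \<nu>"] by (simp add: zc_cayley)
  then have h: "shear K v = shear K v'"
    using nz t by (simp add: frac_eq_eq algebra_simps)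
  have "(of_real (sqrt t) / (of_real t + shear K v)) *s tp \<nu> v
      = (of_real (sqrt t) / (of_real t + shear K v)) *s tp \<nu> v'"
    using arg_cong[OF eq, of "tp \<nu>"] by (simp add: tp_cayley h)
  then have tp: "tp \<nu> v = tp \<nu> v'"
    using nz t by (simp add: vec_eq_iff)
  have "(\<zeta> v - \<zeta> v') * (1 + of_real K * (\<zeta> v + \<zeta> v')) = 0"
    using h by (simp add: shear_def tp algebra_simps power2_eq_square)
  moreover have "1 + of_real K * (\<zeta> v + \<zeta> v') \<noteq> 0"
  proof -
    have "0 < Re (1 + of_real K * (\<zeta> v + \<zeta> v'))"
      using Re_zc_pos[OF assms(1)] Re_zc_pos[OF assms(2)] K by (simp add: add_pos_pos)
    then show ?thesis by (metis less_irrefl zero_complex.simps(1))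
  qed
  ultimately have "\<zeta> v = \<zeta> v'" by simp
  then show "v = v'" using zc_tp_decomp[of v \<nu>] zc_tp_decomp[of v' \<nu>] tp by simp
qed

text \<open>The preimage is explicit: the first component of \<open>w\<close> gives the shear, the
  second gives the tangential part, and \<open>\<zeta>\<close> solves a quadratic equation. The
  margin \<open>\<epsilon>\<close> in \<open>qnorm w\<close> then outweighs the Taylor
  error.\<close>

lemma cayley_onto:
  assumes w: "qnorm w \<le> 1 - \<epsilon>" and eps: "0 < \<epsilon>" "\<epsilon> < 1" and K: "0 < K"
    and N: "N = 5 / \<epsilon> + 8 * M / (\<epsilon>\<^sup>2 * c)" and eta: "\<eta> = \<epsilon> / (24 * N)"
    and t: "0 < t" "t \<le> \<epsilon> / (64 * K * N\<^sup>2)" "2 * N * t + sqrt (N * t) < r \<eta>"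
  shows "\<exists>v. x + v \<in> \<Omega> \<and> of_real t + shear K v \<noteq> 0 \<and> cayley K t v = w"
proof -
  note pos = c_pos M_ge
  have Nge: "5 / \<epsilon> \<le> N" "8 / (\<epsilon>\<^sup>2 * c) \<le> N"
  proof -
    show "5 / \<epsilon> \<le> N" using pos eps by (simp add: N)
    have "8 / (\<epsilon>\<^sup>2 * c) \<le> 8 * M / (\<epsilon>\<^sup>2 * c)"
      using pos eps by (intro divide_right_mono) auto
    also have "\<dots> \<le> N" using eps by (simp add: N)
    finally show "8 / (\<epsilon>\<^sup>2 * c) \<le> N" .
  qed
  have N0: "0 < N" using Nge(1) eps by (smt (verit) divide_pos_pos)
  let ?a = "\<zeta> w"
  \<comment> \<open>The required value of \<open>t + shear K v\<close>, from inverting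
    \<open>a = (t - h) / (t + h)\<close>.\<close>
  define \<Lambda> where "\<Lambda> = 2 * of_real t / (1 + ?a)"
  define p where "p = (\<Lambda> / of_real (sqrt t)) *s tp \<nu> w"
  have "(cmod ?a)\<^sup>2 \<le> 1 - \<epsilon>" using w levi_nonneg[of w] by (simp add: qnorm_def)
  also have "1 - \<epsilon> \<le> (1 - \<epsilon> / 2)\<^sup>2" by (simp add: power2_eq_square algebra_simps)
  finally have a: "cmod ?a \<le> 1 - \<epsilon> / 2" using eps by (auto dest: power2_le_imp_le)
  have a1: "\<epsilon> / 2 \<le> cmod (1 + ?a)" using norm_diff_ineq[of 1 ?a] a by simp
  have a2: "cmod (1 + ?a) \<le> 2" using norm_triangle_ineq[of 1 ?a] a eps by simp
  have a0: "1 + ?a \<noteq> 0" using a1 eps by auto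
  have Lam0: "\<Lambda> \<noteq> 0" using a0 t by (simp add: \<Lambda>_def)
  have cLam: "cmod \<Lambda> = 2 * t / cmod (1 + ?a)" using t by (simp add: \<Lambda>_def norm_divide norm_mult)
  have Lam_le: "cmod \<Lambda> \<le> 4 * t / \<epsilon>"
  proof -
    have "2 * t / cmod (1 + ?a) \<le> 2 * t / (\<epsilon> / 2)"
      using a1 a0 eps t by (intro divide_left_mono) auto
    then show ?thesis by (simp add: cLam)
  qed
  have Lam_ge: "t \<le> cmod \<Lambda>"
    using a2 a0 t by (simp add: cLam pos_le_divide_eq)
  have p_tp: "p = tp \<nu> ((\<Lambda> / of_real (sqrt t)) *s w)" by (simp add: p_def tp_smult)
  have zp: "\<zeta> p = 0" by (simp add: p_tp zc_tp[OF nu])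
  have tpp: "tp \<nu> p = p" by (simp add: tp_def zp)
  have p_le: "(norm p)\<^sup>2 \<le> 8 * t / (\<epsilon>\<^sup>2 * c)"
  proof -
    have "2 * (c * (norm (tp \<nu> w))\<^sup>2) \<le> 1"
      using levi_ge[of w] w eps by (simp add: qnorm_def) (smt (verit) zero_le_power2)
    then have 1: "(norm (tp \<nu> w))\<^sup>2 \<le> 1 / (2 * c)" using c_pos by (simp add: field_simps)
    have "(norm p)\<^sup>2 = (cmod \<Lambda>)\<^sup>2 / t * (norm (tp \<nu> w))\<^sup>2"
      using t by (simp add: p_def norm_vector_smult norm_divide power_mult_distrib power_divide)
    also have "\<dots> \<le> (4 * t / \<epsilon>)\<^sup>2 / t * (1 / (2 * c))"
      using Lam_le 1 t c_pos by (intro mult_mono divide_right_mono power_mono) auto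
    also have "\<dots> = 8 * t / (\<epsilon>\<^sup>2 * c)" using t eps c_pos by (simp add: field_simps power2_eq_square)
    finally show ?thesis .
  qed
  define Y where "Y = \<Lambda> - of_real t + q p"
  have Y_le: "cmod Y \<le> N * t"
  proof -
    have "cmod (q p) \<le> M * (8 * t / (\<epsilon>\<^sup>2 * c))"
      using q_le[of p] p_le M_ge unfolding tpp by (meson order_trans mult_left_mono zero_le_one)
    moreover have "cmod Y \<le> cmod \<Lambda> + t + cmod (q p)"
      unfolding Y_def
      using norm_triangle_ineq[of "\<Lambda> - of_real t" "q p"] norm_triangle_ineq4[of \<Lambda> "of_real t"] t
      by simp
    moreover have "t \<le> t / \<epsilon>" using eps t by (simp add: pos_le_divide_eq)
    \<comment> \<open>The constant \<open>N\<close> collects the bounds for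
      \<open>\<Lambda>\<close>, for \<open>t\<close> and for \<open>q p\<close>, in this
      order.\<close>
    moreover have "N * t = 4 * t / \<epsilon> + t / \<epsilon> + M * (8 * t / (\<epsilon>\<^sup>2 * c))"
      unfolding N using eps c_pos by (simp add: field_simps)
    ultimately show ?thesis using Lam_le by linarith
  qed
  \<comment> \<open>The root near zero: the principal square root has nonnegative real part, so
    adding 1 to it gives modulus at least 1 and hence
    \<open>cmod z \<le> 2 * cmod Y\<close>.\<close>
  define z where "z = (csqrt (1 + 4 * of_real K * Y) - 1) / (2 * of_real K)"
  have zY: "z + of_real K * z\<^sup>2 = Y"
  proof -
    let ?s = "csqrt (1 + 4 * of_real K * Y)"
    have "z + of_real K * z\<^sup>2 = (?s\<^sup>2 - 1) / (4 * of_real K)"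
      using K by (simp add: z_def field_simps power2_eq_square)
    then show ?thesis using K by simp
  qed
  have z_le: "cmod z \<le> 2 * (N * t)"
  proof -
    let ?s = "csqrt (1 + 4 * of_real K * Y)"
    have "1 \<le> Re (?s + 1)" using csqrt_principal[of "1 + 4 * of_real K * Y"] by auto
    then have s1: "1 \<le> cmod (?s + 1)" using complex_Re_le_cmod[of "?s + 1"] by linarith
    have "(?s + 1) * (?s - 1) = ?s\<^sup>2 - 1" by (simp add: algebra_simps power2_eq_square)
    then have "(?s + 1) * z = 2 * Y" using K by (simp add: z_def field_simps)
    then have "cmod (?s + 1) * cmod z = 2 * cmod Y" by (metis norm_mult norm_numeral)
    then have "cmod z \<le> 2 * cmod Y" using mult_right_mono[OF s1, of "cmod z"] by simp
    then show ?thesis using Y_le by simp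
  qed
  define v where "v = z *s \<nu> + p"
  have zv: "\<zeta> v = z" and tv: "tp \<nu> v = p"
    unfolding v_def by (simp_all add: zc_tp_parts[OF nu zp])
  have hv: "of_real t + shear K v = \<Lambda>"
    using zY by (simp add: shear_def zv tv Y_def tpp)
  have "cayley K t v = w"
  proof -
    have "(of_real t - shear K v) / (of_real t + shear K v) = 2 * of_real t / \<Lambda> - 1"
      using Lam0 hv[symmetric] by (simp add: field_simps)
    also have "\<dots> = \<zeta> w" using t a0 by (simp add: \<Lambda>_def)
    finally show ?thesis
      using Lam0 t zc_tp_decomp[of w \<nu>] by (simp add: cayley_def hv tv p_def)
  qed
  moreover have "x + v \<in> \<Omega>"
  proof (rule taylor_lower)
    show eta0: "0 < \<eta>" using eps N0 by (simp add: eta)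
    have p2: "(norm p)\<^sup>2 \<le> N * t"
    proof -
      have "8 / (\<epsilon>\<^sup>2 * c) * t \<le> N * t" using Nge(2) t by (intro mult_right_mono) auto
      then show ?thesis using p_le by simp
    qed
    then have "norm p \<le> sqrt (N * t)" by (rule real_le_rsqrt)
    moreover have "norm v \<le> cmod z + norm p"
      unfolding v_def using norm_triangle_ineq[of "z *s \<nu>" p] nu by (simp add: norm_vector_smult)
    ultimately show "norm v < r \<eta>" using z_le t(3) by linarith
    have "\<eta> * (cmod z + (norm p)\<^sup>2) \<le> \<eta> * (3 * (N * t))"
      using z_le p2 eta0 by (intro mult_left_mono) auto
    also have "\<dots> = \<epsilon> * t / 8" using N0 by (simp add: eta)
    finally have err: "\<eta> * (cmod z + (norm p)\<^sup>2) \<le> \<epsilon> * t / 8" .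
    have "qnorm w = 1 - 2 * t * (2 * Re (shear K v) - L v) / (cmod \<Lambda>)\<^sup>2"
      using qnorm_cayley[OF t(1), of K v] Lam0 \<open>cayley K t v = w\<close> by (simp add: hv)
    then have "\<epsilon> \<le> 2 * t * (2 * Re (shear K v) - L v) / (cmod \<Lambda>)\<^sup>2" using w by simp
    then have "\<epsilon> * (cmod \<Lambda>)\<^sup>2 \<le> 2 * t * (2 * Re (shear K v) - L v)"
      using Lam0 by (simp add: pos_le_divide_eq)
    moreover have "\<epsilon> * t\<^sup>2 \<le> \<epsilon> * (cmod \<Lambda>)\<^sup>2"
      using Lam_ge t eps by (intro mult_left_mono power_mono) auto
    ultimately have "t * (\<epsilon> * t) \<le> t * (2 * (2 * Re (shear K v) - L v))"
      by (simp add: power2_eq_square algebra_simps)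
    \<comment> \<open>The margin is \<open>\<epsilon> * t / 2\<close>; the Taylor error and the term
      from \<open>K\<close> each use up at most \<open>\<epsilon> * t / 8\<close>.\<close>
    then have E: "\<epsilon> * t / 2 \<le> 2 * Re (shear K v) - L v" using t by simp
    have "Re (z\<^sup>2) \<le> (cmod z)\<^sup>2" using complex_Re_le_cmod[of "z\<^sup>2"] by (simp add: norm_power)
    also have "\<dots> \<le> (2 * (N * t))\<^sup>2" using z_le by (intro power_mono) auto
    finally have "2 * K * Re (z\<^sup>2) \<le> 2 * K * (2 * (N * t))\<^sup>2" using K by (intro mult_left_mono) auto
    also have "\<dots> = 8 * K * N\<^sup>2 * t * t" by (simp add: power2_eq_square)
    also have "\<dots> \<le> 8 * K * N\<^sup>2 * (\<epsilon> / (64 * K * N\<^sup>2)) * t"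
      using t K by (intro mult_right_mono mult_left_mono) auto
    also have "\<dots> = \<epsilon> * t / 8" using K N0 by simp
    finally have "2 * K * Re (z\<^sup>2) \<le> \<epsilon> * t / 8" .
    moreover have "0 < \<epsilon> * t" using eps t by simp
    ultimately show "B (tp \<nu> v) (tp \<nu> v) + \<eta> * (cmod (\<zeta> v) + (norm (tp \<nu> v))\<^sup>2) < 2 * Re (\<zeta> v)"
      using E err form_decomp[of p] by (simp add: shear_def zv tv tpp)
  qed
  ultimately show ?thesis using hv Lam0 by blast
qed

section \<open>Euclidean coordinates and the squeezing estimate at one boundary point\<close>

text \<open>The polarization \<open>b\<close> of \<open>qnorm\<close> is invariant under
  \<open>\<i>\<close>, and positive because the Levi form dominates the squared norm of the
  tangential part.\<close>

lemma qnorm_coordinates: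
  obtains T :: "complex ^ 'n \<Rightarrow> complex ^ 'n" where "linear T" "bij T"
    "\<And>v. T (\<i> *s v) = \<i> *s T v" "\<And>v. (norm (T v))\<^sup>2 = qnorm v"
proof -
  interpret Lv: bounded_bilinear "levi B" by (rule bounded_bilinear_levi)
  define b where "b v w = \<zeta> v \<bullet> \<zeta> w + 2 * levi B (tp \<nu> v) (tp \<nu> w)" for v w
  note lin = linear_add[OF linear_zc] linear_scale[OF linear_zc]
    linear_add[OF linear_tp] linear_scale[OF linear_tp]
  have "linear (b v)" "linear (\<lambda>v. b v w)" for v w
    by (rule linearI; simp add: b_def lin Lv.add_left Lv.add_right Lv.scaleR_left Lv.scaleR_right
        inner_simps algebra_simps)+
  then have bil: "bounded_bilinear b"
    by (simp add: bilinear_conv_bounded_bilinear[symmetric] bilinear_def)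
  have b_self: "b v v = qnorm v" for v
    by (simp add: b_def qnorm_def power2_norm_eq_inner)
  show ?thesis
  proof (rule hermitian_form_unitary_coordinates[of b])
    show "bounded_bilinear b" by (rule bil)
    show "b v w = b w v" for v w
      by (simp add: b_def inner_commute levi_sym[of "tp \<nu> v"])
    show "b (\<i> *s v) (\<i> *s w) = b v w" for v w
      by (simp add: b_def zc_smult tp_smult levi_I inner_complex_def)
    show "b v v > 0" if "v \<noteq> 0" for v
    proof -
      have "0 < (cmod (\<zeta> v))\<^sup>2 + (norm (tp \<nu> v))\<^sup>2"
        using that by (simp flip: norm_zc_tp[OF nu])
      then have "0 < (cmod (\<zeta> v))\<^sup>2 \<or> 0 < c * (norm (tp \<nu> v))\<^sup>2"
        using c_pos by auto
      then show ?thesis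
        using levi_ge[of v] levi_nonneg[of v] unfolding b_self qnorm_def
        by (smt (verit) zero_le_power2)
    qed
  qed (use that b_self in simp)
qed

lemma cdiff_shear: "cdiff_at (\<lambda>y. shear K (y - x)) z"
  unfolding shear_def power2_eq_square
  by (intro cdiff_minus cdiff_add cdiff_mult cdiff_const cdiff_zc cdiff_hpart)

text \<open>The choice of \<open>t\<close> as the shear of \<open>s *\<^sub>R \<nu>\<close> sends
  the base point to 0. Since \<open>qnorm\<close> is a squared norm, the radii come from
  \<open>1 + \<epsilon> < (1 + \<epsilon>)^2\<close> and
  \<open>(1 - \<epsilon>)^2 \<le> 1 - \<epsilon>\<close>.\<close>

lemma squeezing_near_one:
  assumes eps: "0 < \<epsilon>" "\<epsilon> < 1" and K: "0 < K" and q: "x + s *\<^sub>R \<nu> \<in> \<Omega>" "0 < s"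
    and t: "t = s + K * s\<^sup>2"
    and bound: "\<And>v. x + v \<in> \<Omega> \<Longrightarrow> of_real t + shear K v \<noteq> 0 \<and> qnorm (cayley K t v) \<le> 1 + \<epsilon>"
    and onto: "\<And>w. qnorm w \<le> 1 - \<epsilon> \<Longrightarrow> \<exists>v. x + v \<in> \<Omega> \<and> cayley K t v = w"
  shows "(1 - \<epsilon>) / (1 + \<epsilon>) \<le> squeezing \<Omega> (x + s *\<^sub>R \<nu>)" "squeezing \<Omega> (x + s *\<^sub>R \<nu>) \<le> 1"
proof -
  obtain T :: "complex ^ 'n \<Rightarrow> complex ^ 'n" where T: "linear T" "bij T"
    "\<And>v. T (\<i> *s v) = \<i> *s T v" "\<And>v. (norm (T v))\<^sup>2 = qnorm v"
    by (rule qnorm_coordinates) blast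
  have t0: "0 < t" using K q(2) by (simp add: t add_pos_nonneg)
  define F where "F y = T (cayley K t (y - x))" for y
  have nz: "of_real t + shear K (z - x) \<noteq> 0" if "z \<in> \<Omega>" for z
    using bound[of "z - x"] that by simp
  have 1: "inj_on F \<Omega>"
  proof (rule inj_onI)
    fix y z assume yz: "y \<in> \<Omega>" "z \<in> \<Omega>" "F y = F z"
    then have "cayley K t (y - x) = cayley K t (z - x)"
      using T(2) by (simp add: F_def bij_def inj_eq)
    then have "y - x = z - x"
      using yz nz t0 K by (intro cayley_inj[of "y - x" "z - x" K t]) auto
    then show "y = z" by simp
  qed
  have 2: "holo_on F \<Omega>"
    unfolding F_def cayley_def
    by (rule holo_on_smult_linear[OF T(1) T(3)])
      (use nz in \<open>intro cdiff_divide cdiff_minus cdiff_add cdiff_const cdiff_shear; blast\<close>)+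
  have z\<nu>: "\<zeta> (s *\<^sub>R \<nu>) = of_real s" "tp \<nu> (s *\<^sub>R \<nu>) = 0"
    by (simp_all add: scaleR_eq_smult zc_smult tp_def zc_self[OF nu])
  have "shear K (s *\<^sub>R \<nu>) = of_real t"
    using bounded_bilinear.zero_left[OF bounded_bilinear_hpart, of 0]
    by (simp add: shear_def z\<nu> t)
  then have 3: "F (x + s *\<^sub>R \<nu>) = 0"
    by (simp add: F_def cayley_def z\<nu> linear_0[OF T(1)])
  have 4: "norm (F z) < 1 + \<epsilon>" if "z \<in> \<Omega>" for z
  proof -
    have "(norm (F z))\<^sup>2 \<le> 1 + \<epsilon>" using bound[of "z - x"] that by (simp add: F_def T(4))
    also have "\<dots> < (1 + \<epsilon>)\<^sup>2" using eps by (simp add: power2_eq_square algebra_simps add_pos_pos)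
    finally show ?thesis using eps by (auto dest: power2_less_imp_less)
  qed
  have 5: "ball 0 (1 - \<epsilon>) \<subseteq> F ` \<Omega>"
  proof
    fix y :: "complex ^ 'n" assume "y \<in> ball 0 (1 - \<epsilon>)"
    then have y: "norm y < 1 - \<epsilon>" by simp
    obtain w where w: "y = T w" using T(2) by (metis bij_pointE)
    have "qnorm w = (norm y)\<^sup>2" by (simp add: w T(4))
    also have "\<dots> \<le> (1 - \<epsilon>)\<^sup>2" using y by (intro power_mono) auto
    also have "\<dots> \<le> 1 - \<epsilon>" using eps by (simp add: power2_eq_square mult_left_le)
    finally obtain v where "x + v \<in> \<Omega>" "cayley K t v = w" using onto by blast
    then show "y \<in> F ` \<Omega>" by (intro image_eqI[of _ _ "x + v"]) (simp_all add: F_def w)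
  qed
  show "(1 - \<epsilon>) / (1 + \<epsilon>) \<le> squeezing \<Omega> (x + s *\<^sub>R \<nu>)" "squeezing \<Omega> (x + s *\<^sub>R \<nu>) \<le> 1"
    using squeezing_between[OF 1 2 3 4 5] eps by simp_all
qed

end

section \<open>Choice of constants uniform in the boundary point\<close>

lemma eventually_small_mult_at_right_0:
  "0 < (b :: real) \<Longrightarrow> eventually (\<lambda>t. a * t < b) (at_right 0)"
proof -
  assume "0 < b"
  moreover have "((\<lambda>t. a * t) \<longlongrightarrow> a * 0) (at_right 0)" by (intro tendsto_intros)
  ultimately show ?thesis by (intro order_tendstoD) simp_all
qed

text \<open>The choices run from \<open>K\<close> over \<open>R\<close> and \<open>N\<close> to the
  Taylor tolerances and finally the bound on \<open>t\<close>, using only data common to all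
  boundary points. That \<open>s0\<close> precedes \<open>x\<close> lets the base point move with
  the point of the domain.\<close>

lemma squeezing_uniformly_near_one:
  fixes r :: "real \<Rightarrow> real"
  assumes const: "0 < \<kappa>" "0 < c" "1 \<le> M" "0 < D" and r: "\<And>\<eta>. 0 < \<eta> \<Longrightarrow> 0 < r \<eta>"
    and eps: "0 < \<epsilon>" "\<epsilon> < 1"
  shows "\<exists>s0>0. \<forall>B \<Omega> (x :: complex ^ 'n) \<nu> s. boundary_model B \<kappa> c M D r \<Omega> x \<nu> \<longrightarrow>
      x + s *\<^sub>R \<nu> \<in> \<Omega> \<longrightarrow> 0 < s \<longrightarrow> s < s0 \<longrightarrow>
      (1 - \<epsilon>) / (1 + \<epsilon>) \<le> squeezing \<Omega> (x + s *\<^sub>R \<nu>) \<and> squeezing \<Omega> (x + s *\<^sub>R \<nu>) \<le> 1"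
proof -
  define \<eta>\<^sub>0 where "\<eta>\<^sub>0 = c / (4 * M)"
  have eta0: "0 < \<eta>\<^sub>0" using const by (simp add: \<eta>\<^sub>0_def)
  define \<sigma> where "\<sigma> = \<kappa> * (r \<eta>\<^sub>0)\<^sup>2"
  have sigma: "0 < \<sigma>" using const r[OF eta0] by (simp add: \<sigma>_def)
  define K where "K = (1 + M * D\<^sup>2 / \<sigma>) / \<sigma>"
  have K: "0 < K" "1 + M * D\<^sup>2 / \<sigma> \<le> K * \<sigma>"
    using sigma const by (simp_all add: K_def add_pos_nonneg)
  \<comment> \<open>Makes the bound \<open>1 + 8 * \<tau>\<close> of \<open>cayley_bound\<close>
    equal to \<open>1 + \<epsilon>\<close>.\<close>
  define \<tau> where "\<tau> = \<epsilon> / 8"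
  have tau: "0 < \<tau>" "\<tau> \<le> 1" using eps by (simp_all add: \<tau>_def)
  \<comment> \<open>The value of \<open>c'\<close>, fixed before any boundary point is
    given.\<close>
  define d where "d = c / (2 * (c + 4 * M))"
  have d: "0 < d" using const by (simp add: d_def)
  define R where "R = (2 + M / (\<kappa> * d)) / (d * \<tau>)"
  have R: "0 < R" using const d tau by (simp add: R_def add_pos_nonneg)
  define \<eta>\<^sub>1 where "\<eta>\<^sub>1 = \<tau> / (2 * R * (1 + 1 / \<kappa>))"
  have eta1: "0 < \<eta>\<^sub>1" using tau R const by (simp add: \<eta>\<^sub>1_def add_pos_pos)
  define N where "N = 5 / \<epsilon> + 8 * M / (\<epsilon>\<^sup>2 * c)"
  have N: "0 < N" using eps const by (simp add: N_def add_pos_pos)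
  define \<eta>\<^sub>2 where "\<eta>\<^sub>2 = \<epsilon> / (24 * N)"
  have eta2: "0 < \<eta>\<^sub>2" using eps N by (simp add: \<eta>\<^sub>2_def)
  have "((\<lambda>t. 2 * N * t + sqrt (N * t)) \<longlongrightarrow> 2 * N * 0 + sqrt (N * 0)) (at_right 0)"
    by (intro tendsto_intros)
  then have "eventually (\<lambda>t. 2 * N * t + sqrt (N * t) < r \<eta>\<^sub>2) (at_right 0)"
    using r[OF eta2] by (intro order_tendstoD) simp_all
  moreover have "eventually (\<lambda>t. R * t < \<kappa> * (r \<eta>\<^sub>1)\<^sup>2) (at_right 0)"
    "eventually (\<lambda>t. 1 * t < \<tau> / (4 * K * R\<^sup>2)) (at_right 0)"
    "eventually (\<lambda>t. 1 * t < \<epsilon> / (64 * K * N\<^sup>2)) (at_right 0)"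
    using const r[OF eta1] tau K R N eps by (intro eventually_small_mult_at_right_0; simp)+
  ultimately have "eventually (\<lambda>t. 2 * N * t + sqrt (N * t) < r \<eta>\<^sub>2 \<and> R * t < \<kappa> * (r \<eta>\<^sub>1)\<^sup>2
      \<and> t \<le> \<tau> / (4 * K * R\<^sup>2) \<and> t \<le> \<epsilon> / (64 * K * N\<^sup>2)) (at_right 0)"
    by eventually_elim auto
  then obtain t0 where t0: "0 < t0" "\<And>t. 0 < t \<Longrightarrow> t < t0 \<Longrightarrow> 2 * N * t + sqrt (N * t) < r \<eta>\<^sub>2
      \<and> R * t < \<kappa> * (r \<eta>\<^sub>1)\<^sup>2 \<and> t \<le> \<tau> / (4 * K * R\<^sup>2) \<and> t \<le> \<epsilon> / (64 * K * N\<^sup>2)"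
    unfolding eventually_at_right_field by blast
  show ?thesis
  \<comment> \<open>For \<open>s\<close> below 1 the parameter \<open>t = s + K * s^2\<close> is at
    most \<open>(1 + K) * s\<close>, so this bound gives \<open>t < t0\<close>.\<close>
  proof (intro exI[of _ "min 1 (t0 / (1 + K))"] conjI[of "0 < _"] allI impI)
    show "0 < min 1 (t0 / (1 + K))" using t0(1) K(1) by simp
  next
    fix B \<Omega> and x \<nu> :: "complex ^ 'n" and s
    assume model: "boundary_model B \<kappa> c M D r \<Omega> x \<nu>"
      and s: "x + s *\<^sub>R \<nu> \<in> \<Omega>" "0 < s" "s < min 1 (t0 / (1 + K))"
    interpret boundary_model B \<kappa> c M D r \<Omega> x \<nu> by (rule model)
    have c'_eq: "c' = d" unfolding d_def c'_def ..
    define t where "t = s + K * s\<^sup>2"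
    have t_pos: "0 < t" using s K(1) by (simp add: t_def add_pos_nonneg)
    have "s\<^sup>2 \<le> s" using s by (simp add: power2_eq_square mult_left_le)
    then have "t \<le> (1 + K) * s" using K(1) by (simp add: t_def algebra_simps)
    also have "\<dots> < t0" using s(3) K(1) by (simp add: field_simps)
    finally have "t < t0" .
    note t = t0(2)[OF t_pos this]
    have low: "d * cmod (\<zeta> v) \<le> cmod (shear K v)" if "x + v \<in> \<Omega>" for v
      using shear_ge[OF that eta0 _ \<sigma>_def K(2,1)] by (simp add: \<eta>\<^sub>0_def c'_eq)
    have bound: "of_real t + shear K v \<noteq> 0 \<and> qnorm (cayley K t v) \<le> 1 + \<epsilon>"
      if "x + v \<in> \<Omega>" for v
      using cayley_bound[OF that, unfolded c'_eq, OF low[OF that] K(1) tau R_def \<eta>\<^sub>1_def t_pos] t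
      by (simp add: \<tau>_def)
    have onto: "\<exists>v. x + v \<in> \<Omega> \<and> cayley K t v = w" if "qnorm w \<le> 1 - \<epsilon>" for w
      using cayley_onto[OF that eps K(1) N_def \<eta>\<^sub>2_def t_pos] t by blast
    show "(1 - \<epsilon>) / (1 + \<epsilon>) \<le> squeezing \<Omega> (x + s *\<^sub>R \<nu>) \<and> squeezing \<Omega> (x + s *\<^sub>R \<nu>) \<le> 1"
      using squeezing_near_one[OF eps K(1) s(1,2) t_def bound onto] by blast
  qed
qed

subsection \<open>Convexity\<close>

text \<open>The pairs of points joined by a segment inside \<open>\<Omega>\<close> form a clopen subset of the connected
  set \<open>\<Omega> \<times> \<Omega>\<close>: a limit segment touching the boundary would contradict the strict support there.\<close>

lemma convex_if_locally_strictly_supported: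
  fixes \<Omega> :: "'a :: euclidean_space set"
  assumes "open \<Omega>" "connected \<Omega>"
    and supp: "\<And>x. x \<in> frontier \<Omega> \<Longrightarrow> \<exists>\<nu>. \<exists>\<delta>>0. \<forall>y\<in>closure \<Omega>. y \<noteq> x \<longrightarrow> norm (y - x) < \<delta> \<longrightarrow> 0 < \<nu> \<bullet> (y - x)"
  shows "convex \<Omega>"
proof -
  define S where "S = {ab \<in> \<Omega> \<times> \<Omega>. closed_segment (fst ab) (snd ab) \<subseteq> \<Omega>}"
  have "open S"
    unfolding open_dist
  proof
    fix ab assume "ab \<in> S"
    then obtain a b where ab: "ab = (a, b)" "a \<in> \<Omega>" "b \<in> \<Omega>" "closed_segment a b \<subseteq> \<Omega>"
      by (auto simp: S_def)
    obtain e where e: "0 < e" "(\<Union>z\<in>closed_segment a b. ball z e) \<subseteq> \<Omega>"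
      using compact_subset_open_imp_ball_epsilon_subset[OF compact_segment \<open>open \<Omega>\<close> ab(4)] by blast
    have "ab' \<in> S" if "dist ab' ab < e" for ab'
    proof -
      obtain a' b' where ab': "ab' = (a', b')" by (cases ab')
      have d: "norm (a' - a) < e" "norm (b' - b) < e"
        using that dist_fst_le[of ab' ab] dist_snd_le[of ab' ab] by (auto simp: ab ab' dist_norm)
      have seg: "(1 - u) *\<^sub>R a' + u *\<^sub>R b' \<in> \<Omega>" if u: "0 \<le> u" "u \<le> 1" for u
      proof -
        have "(1 - u) *\<^sub>R (a' - a) + u *\<^sub>R (b' - b) \<in> ball 0 e"
          by (rule convexD_alt[OF convex_ball]) (use d u in auto)
        then have "norm ((1 - u) *\<^sub>R (a' - a) + u *\<^sub>R (b' - b)) < e" by simp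
        then have "(1 - u) *\<^sub>R a' + u *\<^sub>R b' \<in> ball ((1 - u) *\<^sub>R a + u *\<^sub>R b) e"
          by (simp add: dist_norm norm_minus_commute algebra_simps)
        moreover have "(1 - u) *\<^sub>R a + u *\<^sub>R b \<in> closed_segment a b"
          using u by (auto simp: in_segment)
        ultimately show ?thesis using e(2) by blast
      qed
      show ?thesis
        using seg[of 0] seg[of 1] seg by (auto simp: S_def ab' in_segment)
    qed
    then show "\<exists>e>0. \<forall>y. dist y ab < e \<longrightarrow> y \<in> S" using e(1) by blast
  qed
  have "ab \<in> S" if "ab \<in> \<Omega> \<times> \<Omega>" "ab \<in> closure S" for ab
  proof -
    obtain a b where ab: "ab = (a, b)" "a \<in> \<Omega>" "b \<in> \<Omega>" using \<open>ab \<in> \<Omega> \<times> \<Omega>\<close> by auto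
    define f where "f u = (1 - u) *\<^sub>R a + u *\<^sub>R b" for u :: real
    have cl: "f u \<in> closure \<Omega>" if u: "0 \<le> u" "u \<le> 1" for u
    proof -
      \<comment> \<open>Evaluating segments at the fixed parameter \<open>u\<close> is continuous,
        so limits of segments in the domain stay in its closure.\<close>
      define F where "F z = (1 - u) *\<^sub>R fst z + u *\<^sub>R snd z" for z :: "'a \<times> 'a"
      have "F z \<in> closed_segment (fst z) (snd z)" for z
        using u by (auto simp: F_def in_segment)
      then have "F z \<in> \<Omega>" if "z \<in> S" for z using that unfolding S_def by blast
      then have "F ` S \<subseteq> closure \<Omega>" using closure_subset by blast
      moreover have "continuous_on (closure S) F"
        unfolding F_def by (intro continuous_intros)
      ultimately have "F ` closure S \<subseteq> closure \<Omega>"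
        by (intro image_closure_subset) auto
      then show ?thesis using \<open>ab \<in> closure S\<close> by (auto simp: F_def f_def ab)
    qed
    have "f u \<in> \<Omega>" if u: "0 \<le> u" "u \<le> 1" for u
    proof (rule ccontr)
      assume out: "f u \<notin> \<Omega>"
      then have fr: "f u \<in> frontier \<Omega>"
        using cl[OF u] interior_open[OF \<open>open \<Omega>\<close>] by (simp add: frontier_def)
      then obtain \<nu> \<delta> where nd: "0 < \<delta>"
        "\<And>y. y \<in> closure \<Omega> \<Longrightarrow> y \<noteq> f u \<Longrightarrow> norm (y - f u) < \<delta> \<Longrightarrow> 0 < \<nu> \<bullet> (y - f u)"
        using supp by blast
      have "u \<noteq> 0" "u \<noteq> 1" "a \<noteq> b"
        using out ab by (auto simp: f_def simp flip: scaleR_add_left)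
      \<comment> \<open>A step in either direction stays on the segment and within
        \<open>\<delta>\<close> of \<open>f u\<close>. Support then makes
        \<open>\<nu> \<bullet> (b - a)\<close> both positive and negative.\<close>
      define h where "h = min (min u (1 - u)) (\<delta> / (2 * norm (b - a)))"
      have h: "0 < h" "h \<le> u" "h \<le> 1 - u" "h \<le> \<delta> / (2 * norm (b - a))"
        using \<open>u \<noteq> 0\<close> \<open>u \<noteq> 1\<close> \<open>a \<noteq> b\<close> u nd(1) by (auto simp: h_def)
      have hn: "h * norm (b - a) < \<delta>"
        using h(4) \<open>a \<noteq> b\<close> nd(1) by (simp add: field_simps)
      have df: "f (u + k) - f u = k *\<^sub>R (b - a)" for k
        by (simp add: f_def algebra_simps)
      have "0 < \<nu> \<bullet> (f (u + k) - f u)" if "\<bar>k\<bar> = h" for k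
      proof (rule nd(2))
        show "f (u + k) \<in> closure \<Omega>" by (rule cl) (use that h in auto)
        show "f (u + k) \<noteq> f u" using df[of k] that h(1) \<open>a \<noteq> b\<close> by auto
        show "norm (f (u + k) - f u) < \<delta>" using hn that by (simp add: df)
      qed
      from this[of h] this[of "- h"] h(1)
      have "0 < \<nu> \<bullet> (h *\<^sub>R (b - a))" "0 < \<nu> \<bullet> (- h *\<^sub>R (b - a))"
        unfolding df by simp_all
      then show False by simp
    qed
    then show ?thesis using ab by (auto simp: S_def in_segment f_def)
  qed
  moreover have "S \<subseteq> \<Omega> \<times> \<Omega>" by (auto simp: S_def)
  ultimately have "S = (\<Omega> \<times> \<Omega>) \<inter> closure S" using closure_subset[of S] by blast
  then have "closedin (top_of_set (\<Omega> \<times> \<Omega>)) S" unfolding closedin_closed by blast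
  moreover have "openin (top_of_set (\<Omega> \<times> \<Omega>)) S"
    using \<open>open S\<close> by (intro open_subset) (auto simp: S_def)
  moreover have "connected (\<Omega> \<times> \<Omega>)" using \<open>connected \<Omega>\<close> by (simp add: connected_Times)
  ultimately have "S = {} \<or> S = \<Omega> \<times> \<Omega>" unfolding connected_clopen by blast
  moreover have "(a, a) \<in> S" if "a \<in> \<Omega>" for a using that by (simp add: S_def)
  ultimately have "S = \<Omega> \<times> \<Omega>" by auto
  have "closed_segment a b \<subseteq> \<Omega>" if "a \<in> \<Omega>" "b \<in> \<Omega>" for a b
  proof -
    have "(a, b) \<in> S" using \<open>S = \<Omega> \<times> \<Omega>\<close> that by simp
    then show ?thesis by (simp add: S_def)
  qed
  then show ?thesis by (simp add: convex_contains_segment)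
qed

lemma blinfun_inner_le:
  fixes F :: "'a :: real_inner \<Rightarrow>\<^sub>L 'a"
  assumes "norm F \<le> K"
  shows "\<bar>blinfun_apply F a \<bullet> b\<bar> \<le> K * norm a * norm b"
proof -
  have "\<bar>blinfun_apply F a \<bullet> b\<bar> \<le> norm (blinfun_apply F a) * norm b" by (rule Cauchy_Schwarz_ineq2)
  also have "\<dots> \<le> (norm F * norm a) * norm b" by (intro mult_right_mono norm_blinfun) auto
  also have "\<dots> \<le> K * norm a * norm b" using assms by (intro mult_right_mono) auto
  finally show ?thesis .
qed

subsection \<open>Domains with strongly convex boundary\<close>

locale strongly_convex_domain =
  fixes \<Omega> :: "(complex ^ 'n) set" and \<rho> g H
  assumes opn: "open \<Omega>" and conn: "connected \<Omega>" and bdd: "bounded \<Omega>" and fr_nonempty: "frontier \<Omega> \<noteq> {}"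
    and C2: "C2_defining_function \<Omega> \<rho> g H"
    and strong: "\<And>x v. x \<in> frontier \<Omega> \<Longrightarrow> v \<noteq> 0 \<Longrightarrow> g x \<bullet> v = 0 \<Longrightarrow> 0 < blinfun_apply (H x) v \<bullet> v"
begin

lemma rho_deriv: "(\<rho> has_derivative (\<lambda>v. g x \<bullet> v)) (at x)"
  and g_deriv: "(g has_derivative blinfun_apply (H x)) (at x)"
  and H_cont: "continuous_on UNIV H"
  and Omega_eq: "\<Omega> = {x. \<rho> x < 0}"
  and g_nonzero: "x \<in> frontier \<Omega> \<Longrightarrow> g x \<noteq> 0"
  using C2 unfolding C2_defining_function_def by auto

lemma rho_cont: "continuous_on UNIV \<rho>"
  by (intro differentiable_imp_continuous_on)
    (auto simp: differentiable_on_def differentiable_def intro!: exI rho_deriv)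

lemma g_cont: "continuous_on UNIV g"
  by (intro differentiable_imp_continuous_on)
    (auto simp: differentiable_on_def differentiable_def intro!: exI g_deriv)

lemma rho_closure: "y \<in> closure \<Omega> \<Longrightarrow> \<rho> y \<le> 0"
proof -
  have "closed {y. \<rho> y \<le> 0}"
    by (intro closed_Collect_le rho_cont continuous_on_const)
  then have "closure \<Omega> \<subseteq> {y. \<rho> y \<le> 0}"
    by (intro closure_minimal) (auto simp: Omega_eq)
  then show "y \<in> closure \<Omega> \<Longrightarrow> \<rho> y \<le> 0" by blast
qed

lemma frontier_not_in: "x \<in> frontier \<Omega> \<Longrightarrow> x \<notin> \<Omega>"
  using interior_open[OF opn] by (simp add: frontier_def)

lemma rho_frontier: "x \<in> frontier \<Omega> \<Longrightarrow> \<rho> x = 0"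
  using rho_closure[of x] frontier_not_in[of x] Omega_eq by (auto simp: frontier_def)

lemma DERIV_rho_line: "((\<lambda>t. \<rho> (x + t *\<^sub>R v)) has_real_derivative (g (x + t *\<^sub>R v) \<bullet> v)) (at t)"
  unfolding has_field_derivative_def
  by (rule has_derivative_eq_rhs, rule has_derivative_compose[OF _ rho_deriv])
    (auto intro!: derivative_eq_intros simp: mult.commute)

lemma DERIV_g_line: "((\<lambda>t. g (x + t *\<^sub>R v) \<bullet> v) has_real_derivative (H (x + t *\<^sub>R v) v \<bullet> v)) (at t)"
proof -
  have "((\<lambda>t. g (x + t *\<^sub>R v)) has_derivative (\<lambda>h. H (x + t *\<^sub>R v) (h *\<^sub>R v))) (at t)"
    by (rule has_derivative_compose[OF _ g_deriv]) (auto intro!: derivative_eq_intros)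
  from has_derivative_inner_left[OF this, of v] show ?thesis
    unfolding has_field_derivative_def
    by (rule has_derivative_eq_rhs) (auto simp: blinfun.scaleR_right)
qed

lemma taylor2:
  assumes "x \<in> frontier \<Omega>"
  obtains y where "norm (y - x) \<le> norm v" "2 * \<rho> (x + v) = 2 * (g x \<bullet> v) + H y v \<bullet> v"
proof -
  \<comment> \<open>The successive derivatives along the line, in the indexed form that
    \<open>Maclaurin2\<close> expects; index 2 supplies the remainder.\<close>
  define d where "d m t = (if m = 0 then \<rho> (x + t *\<^sub>R v)
    else if m = 1 then g (x + t *\<^sub>R v) \<bullet> v else H (x + t *\<^sub>R v) v \<bullet> v)" for m :: nat and t :: real
  have "\<forall>m t. m < 2 \<and> 0 \<le> t \<and> t \<le> 1 \<longrightarrow> (d m has_real_derivative d (Suc m) t) (at t)"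
    using DERIV_rho_line[of x v] DERIV_g_line[of x v]
    by (auto simp: d_def[abs_def] less_2_cases_iff)
  from Maclaurin2[of 1 d "d 0" 2, OF _ _ this] obtain t where
    t: "0 < t" "t \<le> 1" "d 0 1 = (\<Sum>m<2. d m 0 / fact m * 1 ^ m) + d 2 t / fact 2 * 1\<^sup>2"
    by auto
  show ?thesis
  proof
    show "norm (x + t *\<^sub>R v - x) \<le> norm v" using t by (simp add: mult_left_le_one_le)
    show "2 * \<rho> (x + v) = 2 * (g x \<bullet> v) + H (x + t *\<^sub>R v) v \<bullet> v"
      using t(3) rho_frontier[OF assms] by (simp add: d_def eval_nat_numeral)
  qed
qed

lemma compact_frontier': "compact (frontier \<Omega>)"
  using bdd by (simp add: compact_frontier_bounded)

lemma gradient_bounds: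
  obtains m G where "0 < m" "0 < G" "\<And>x. x \<in> frontier \<Omega> \<Longrightarrow> m \<le> norm (g x) \<and> norm (g x) \<le> G"
proof -
  have c: "continuous_on (frontier \<Omega>) (\<lambda>x. norm (g x))"
    by (intro continuous_on_norm continuous_on_subset[OF g_cont]) auto
  obtain x1 where x1: "x1 \<in> frontier \<Omega>" "\<And>x. x \<in> frontier \<Omega> \<Longrightarrow> norm (g x1) \<le> norm (g x)"
    using continuous_attains_inf[OF compact_frontier' fr_nonempty c] by blast
  obtain x2 where x2: "x2 \<in> frontier \<Omega>" "\<And>x. x \<in> frontier \<Omega> \<Longrightarrow> norm (g x) \<le> norm (g x2)"
    using continuous_attains_sup[OF compact_frontier' fr_nonempty c] by blast
  show ?thesis
    by (rule that[of "norm (g x1)" "norm (g x2)"])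
      (use x1 x2 g_nonzero in auto)
qed

lemma hessian_bound:
  obtains A where "0 \<le> A" "\<And>x. x \<in> frontier \<Omega> \<Longrightarrow> norm (H x) \<le> A"
proof -
  have c: "continuous_on (frontier \<Omega>) (\<lambda>x. norm (H x))"
    by (intro continuous_on_norm continuous_on_subset[OF H_cont]) auto
  obtain x2 where x2: "x2 \<in> frontier \<Omega>" "\<And>x. x \<in> frontier \<Omega> \<Longrightarrow> norm (H x) \<le> norm (H x2)"
    using continuous_attains_sup[OF compact_frontier' fr_nonempty c] by blast
  show ?thesis by (rule that[of "norm (H x2)"]) (use x2 in auto)
qed

text \<open>Compactness of the set of unit tangent vectors over the boundary, then
  homogeneity.\<close>

lemma hessian_lower:
  obtains c where "0 < c" "\<And>x v. x \<in> frontier \<Omega> \<Longrightarrow> g x \<bullet> v = 0 \<Longrightarrow> c * (norm v)\<^sup>2 \<le> H x v \<bullet> v"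
proof -
  define P where "P = (frontier \<Omega> \<times> sphere 0 1) \<inter> {z. g (fst z) \<bullet> snd z = 0}"
  have "continuous_on UNIV (\<lambda>z :: (complex ^ 'n) \<times> (complex ^ 'n). g (fst z) \<bullet> snd z)"
    by (intro continuous_intros continuous_on_compose2[OF g_cont]) auto
  then have "closed {z. g (fst z) \<bullet> snd z = 0}"
    by (intro closed_Collect_eq continuous_on_const)
  then have comp: "compact P"
    unfolding P_def by (intro compact_Int_closed compact_Times compact_frontier' compact_sphere)
  have cont: "continuous_on P (\<lambda>z. H (fst z) (snd z) \<bullet> snd z)"
    by (intro continuous_intros continuous_on_compose2[OF H_cont]) auto
  obtain c where c: "0 < c" "\<And>z. z \<in> P \<Longrightarrow> c \<le> H (fst z) (snd z) \<bullet> snd z"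
  proof (cases "P = {}")
    case True
    then show ?thesis using that[of 1] by auto
  next
    case False
    obtain z where z: "z \<in> P" "\<And>y. y \<in> P \<Longrightarrow> H (fst z) (snd z) \<bullet> snd z \<le> H (fst y) (snd y) \<bullet> snd y"
      using continuous_attains_inf[OF comp False cont] by blast
    have "0 < H (fst z) (snd z) \<bullet> snd z"
      using z(1) by (intro strong) (auto simp: P_def)
    then show ?thesis using that z(2) by blast
  qed
  show ?thesis
  proof (rule that[OF c(1)])
    fix x v assume x: "x \<in> frontier \<Omega>" and v: "g x \<bullet> v = 0"
    show "c * (norm v)\<^sup>2 \<le> H x v \<bullet> v"
    proof (cases "v = 0")
      case False
      define w where "w = (1 / norm v) *\<^sub>R v"
      have "(x, w) \<in> P" using x v False by (simp add: P_def w_def)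
      from c(2)[OF this] have "c \<le> (H x v \<bullet> v) / (norm v)\<^sup>2"
        by (simp add: w_def blinfun.scaleR_right power2_eq_square)
      then show ?thesis using False by (simp add: field_simps)
    qed (simp add: blinfun.zero_right)
  qed
qed

lemma hessian_modulus:
  assumes "0 < \<omega>"
  shows "\<exists>r>0. \<forall>x\<in>frontier \<Omega>. \<forall>y. norm (y - x) < r \<longrightarrow> norm (H y - H x) \<le> \<omega>"
proof -
  obtain b where b: "\<And>x. x \<in> frontier \<Omega> \<Longrightarrow> norm x \<le> b"
    using compact_imp_bounded[OF compact_frontier'] bounded_iff by metis
  have "uniformly_continuous_on (cball 0 (b + 1)) H"
    by (rule compact_uniformly_continuous[OF continuous_on_subset[OF H_cont]]) auto
  then obtain d where d: "0 < d" "\<And>x y. x \<in> cball 0 (b + 1) \<Longrightarrow> y \<in> cball 0 (b + 1) \<Longrightarrow> dist y x < d \<Longrightarrow> dist (H y) (H x) < \<omega>"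
    unfolding uniformly_continuous_on_def using assms by metis
  show ?thesis
  proof (intro exI[of _ "min d 1"] conjI ballI allI impI)
    fix x y assume x: "x \<in> frontier \<Omega>" and y: "norm (y - x) < min d 1"
    have "norm y \<le> b + 1" using b[OF x] y norm_triangle_sub[of y x] by simp
    then show "norm (H y - H x) \<le> \<omega>"
      using d(2)[of x y] b[OF x] y by (simp add: dist_norm less_imp_le)
  qed (use d in auto)
qed

text \<open>Replaces a vector and an intermediate point by a projection and the base point. It
  serves with the real tangential projection in \<open>local_support\<close> and the complex one in
  \<open>taylor_form\<close>.\<close>

lemma hessian_perturb:
  assumes x: "norm (H x) \<le> A" and y: "norm (H y - H x) \<le> \<omega>" and p: "norm p \<le> norm v"
  shows "\<bar>H y v \<bullet> v - H x p \<bullet> p\<bar> \<le> \<omega> * (norm v)\<^sup>2 + 2 * A * norm (v - p) * norm v"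
proof -
  have A0: "0 \<le> A" using x norm_ge_zero order_trans by blast
  have "H y v \<bullet> v - H x p \<bullet> p = (H y - H x) v \<bullet> v + H x v \<bullet> (v - p) + H x (v - p) \<bullet> p"
    by (simp add: blinfun.diff_left blinfun.diff_right inner_simps)
  also have "\<bar>\<dots>\<bar> \<le> \<omega> * norm v * norm v + A * norm v * norm (v - p) + A * norm (v - p) * norm p"
    using blinfun_inner_le[OF y, of v v] blinfun_inner_le[OF x, of v "v - p"]
      blinfun_inner_le[OF x, of "v - p" p] by linarith
  also have "A * norm (v - p) * norm p \<le> A * norm (v - p) * norm v"
    using A0 p by (intro mult_left_mono) auto
  finally show ?thesis by (simp add: power2_eq_square algebra_simps)
qed

text \<open>The minus sign makes the normal point inward, since the domain is where
  \<open>\<rho>\<close> is negative.\<close>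

definition nu :: "complex ^ 'n \<Rightarrow> complex ^ 'n" where
  "nu x = - (1 / norm (g x)) *\<^sub>R g x"

lemma norm_nu: "x \<in> frontier \<Omega> \<Longrightarrow> norm (nu x) = 1"
  using g_nonzero by (simp add: nu_def)

lemma g_inner: "x \<in> frontier \<Omega> \<Longrightarrow> g x \<bullet> v = - norm (g x) * (nu x \<bullet> v)"
  using g_nonzero by (simp add: nu_def)

section \<open>Quadratic support and convexity\<close>

text \<open>Split \<open>v\<close> into its normal component \<open>s\<close> and a real tangential
  part. Since \<open>\<rho>\<close> is nonpositive on the closure, Taylor's formula bounds the
  positive tangential Hessian by a multiple of \<open>s\<close>, up to terms absorbed for small
  \<open>v\<close>.\<close>

lemma local_support:
  obtains \<delta> \<kappa> where "0 < \<delta>" "0 < \<kappa>"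
    "\<And>x v. x \<in> frontier \<Omega> \<Longrightarrow> x + v \<in> closure \<Omega> \<Longrightarrow> norm v < \<delta> \<Longrightarrow> \<kappa> * (norm v)\<^sup>2 \<le> nu x \<bullet> v"
proof -
  obtain m G where mG: "0 < m" "0 < G" "\<And>x. x \<in> frontier \<Omega> \<Longrightarrow> m \<le> norm (g x) \<and> norm (g x) \<le> G"
    by (rule gradient_bounds) blast
  obtain A where A: "0 \<le> A" "\<And>x. x \<in> frontier \<Omega> \<Longrightarrow> norm (H x) \<le> A"
    by (rule hessian_bound) blast
  obtain c where c: "0 < c" "\<And>x v. x \<in> frontier \<Omega> \<Longrightarrow> g x \<bullet> v = 0 \<Longrightarrow> c * (norm v)\<^sup>2 \<le> H x v \<bullet> v"
    by (rule hessian_lower) blast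
  obtain r where r: "0 < r" "\<And>x y. x \<in> frontier \<Omega> \<Longrightarrow> norm (y - x) < r \<Longrightarrow> norm (H y - H x) \<le> c / 2"
    using hessian_modulus[of "c / 2"] c(1) by auto
  \<comment> \<open>The second bound ensures \<open>(2 * A + c) * norm v \<le> norm (g x)\<close>,
    which absorbs the mixed term.\<close>
  define \<delta> where "\<delta> = min r (m / (2 * A + c))"
  have delta: "0 < \<delta>" "\<delta> \<le> r" "(2 * A + c) * \<delta> \<le> m"
  proof -
    have "0 < 2 * A + c" using A c by simp
    moreover have "\<delta> \<le> m / (2 * A + c)" by (simp add: \<delta>_def)
    ultimately show "(2 * A + c) * \<delta> \<le> m" by (simp add: pos_le_divide_eq mult.commute)
    show "0 < \<delta>" "\<delta> \<le> r" using r(1) mG(1) \<open>0 < 2 * A + c\<close> by (simp_all add: \<delta>_def)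
  qed
  show ?thesis
  proof (rule that)
    show "0 < \<delta>" by (rule delta)
    show "0 < c / (6 * G)" using c mG by simp
    fix x v assume x: "x \<in> frontier \<Omega>" and v: "x + v \<in> closure \<Omega>" "norm v < \<delta>"
    define s where "s = nu x \<bullet> v"
    define p where "p = v - s *\<^sub>R nu x"
    note n1 = norm_nu[OF x]
    have s_le: "\<bar>s\<bar> \<le> norm v" using Cauchy_Schwarz_ineq2[of "nu x" v] n1 by (simp add: s_def)
    have nn: "nu x \<bullet> nu x = 1" using n1 by (simp add: norm_eq_1)
    have np: "nu x \<bullet> p = 0" by (simp add: p_def inner_simps nn s_def)
    have p2: "(norm p)\<^sup>2 = (norm v)\<^sup>2 - s\<^sup>2"
      unfolding power2_norm_eq_inner p_def
      by (simp add: inner_simps nn inner_commute[of v "nu x"] flip: s_def) (simp add: power2_eq_square algebra_simps)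
    then have p_le: "norm p \<le> norm v" by (intro power2_le_imp_le[of "norm p"]) auto
    obtain y where y: "norm (y - x) \<le> norm v" "2 * \<rho> (x + v) = 2 * (g x \<bullet> v) + H y v \<bullet> v"
      by (rule taylor2[OF x])
    have "norm (H y - H x) \<le> c / 2" using r(2)[OF x, of y] y(1) v(2) delta(2) by simp
    from hessian_perturb[OF A(2)[OF x] this p_le]
    have "H x p \<bullet> p - (c / 2 * (norm v)\<^sup>2 + 2 * A * \<bar>s\<bar> * norm v) \<le> H y v \<bullet> v"
      using n1 by (simp add: p_def abs_le_iff)
    moreover have "c * ((norm v)\<^sup>2 - s\<^sup>2) \<le> H x p \<bullet> p"
      using c(2)[OF x, of p] g_inner[OF x, of p] np by (simp add: p2)
    moreover have "H y v \<bullet> v \<le> 2 * norm (g x) * s"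
      using rho_closure[OF v(1)] y(2) g_inner[OF x, of v] by (simp add: s_def)
    moreover have "c * (\<bar>s\<bar> * \<bar>s\<bar>) \<le> c * (\<bar>s\<bar> * norm v)"
      using s_le c by (intro mult_left_mono) auto
    then have "c * s\<^sup>2 \<le> c * (\<bar>s\<bar> * norm v)" by (simp add: power2_eq_square)
    ultimately have 1: "c / 2 * (norm v)\<^sup>2 \<le> 2 * norm (g x) * s + (2 * A + c) * norm v * \<bar>s\<bar>"
      by (simp add: algebra_simps)
    have "(2 * A + c) * norm v \<le> (2 * A + c) * \<delta>" using v(2) A c by (intro mult_left_mono) auto
    then have "(2 * A + c) * norm v \<le> norm (g x)" using delta(3) mG(3)[OF x] by linarith
    then have "(2 * A + c) * norm v * \<bar>s\<bar> \<le> norm (g x) * \<bar>s\<bar>" by (intro mult_right_mono) auto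
    with 1 have 2: "c / 2 * (norm v)\<^sup>2 \<le> norm (g x) * (2 * s + \<bar>s\<bar>)" by (simp add: algebra_simps)
    \<comment> \<open>For negative \<open>s\<close> the factor \<open>2 * s + \<bar>s\<bar>\<close>
      would be negative. Hence it equals \<open>3 * s\<close>, which explains the constant
      \<open>6 * G\<close>.\<close>
    have "0 \<le> c / 2 * (norm v)\<^sup>2" using c by simp
    with 2 have "0 \<le> norm (g x) * (2 * s + \<bar>s\<bar>)" by linarith
    then have "0 \<le> 2 * s + \<bar>s\<bar>" using g_nonzero[OF x] by (simp add: zero_le_mult_iff)
    then have s0: "0 \<le> s" by (simp add: abs_if split: if_splits)
    have "norm (g x) * (2 * s + \<bar>s\<bar>) \<le> G * (3 * s)"
      using s0 mG(3)[OF x] by (simp add: mult_right_mono)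
    with 2 show "c / (6 * G) * (norm v)\<^sup>2 \<le> nu x \<bullet> v"
      using mG(2) by (simp add: field_simps flip: s_def)
  qed
qed

lemma convex_Omega: "convex \<Omega>"
proof (rule convex_if_locally_strictly_supported[OF opn conn])
  fix x assume x: "x \<in> frontier \<Omega>"
  obtain \<delta> \<kappa> where dk: "0 < \<delta>" "0 < \<kappa>"
    "\<And>x v. x \<in> frontier \<Omega> \<Longrightarrow> x + v \<in> closure \<Omega> \<Longrightarrow> norm v < \<delta> \<Longrightarrow> \<kappa> * (norm v)\<^sup>2 \<le> nu x \<bullet> v"
    by (rule local_support) blast
  have "0 < nu x \<bullet> (y - x)" if "y \<in> closure \<Omega>" "y \<noteq> x" "norm (y - x) < \<delta>" for y
  proof -
    have "0 < \<kappa> * (norm (y - x))\<^sup>2" using dk(2) that(2) by simp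
    also have "\<dots> \<le> nu x \<bullet> (y - x)" by (rule dk(3)[OF x]) (use that in auto)
    finally show ?thesis .
  qed
  then show "\<exists>\<nu>. \<exists>\<delta>>0. \<forall>y\<in>closure \<Omega>. y \<noteq> x \<longrightarrow> norm (y - x) < \<delta> \<longrightarrow> 0 < \<nu> \<bullet> (y - x)"
    using dk(1) by blast
qed

text \<open>By convexity a long vector can be shortened to length \<open>\<delta> / 2\<close> inside
  the closure. Local support then gives linear growth, which is quadratic growth on a bounded
  set.\<close>

lemma global_support:
  obtains \<kappa> D where "0 < \<kappa>" "0 < D"
    "\<And>x v. x \<in> frontier \<Omega> \<Longrightarrow> x + v \<in> \<Omega> \<Longrightarrow> norm v \<le> D \<and> \<kappa> * (norm v)\<^sup>2 \<le> nu x \<bullet> v"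
proof -
  obtain \<delta> \<kappa> where dk: "0 < \<delta>" "0 < \<kappa>"
    "\<And>x v. x \<in> frontier \<Omega> \<Longrightarrow> x + v \<in> closure \<Omega> \<Longrightarrow> norm v < \<delta> \<Longrightarrow> \<kappa> * (norm v)\<^sup>2 \<le> nu x \<bullet> v"
    by (rule local_support) blast
  obtain b where b: "0 < b" "\<And>x. x \<in> closure \<Omega> \<Longrightarrow> norm x \<le> b"
    using bounded_closure[OF bdd] bounded_pos by metis
  \<comment> \<open>The second entry converts \<open>\<kappa> * \<delta> / 2 * norm v\<close> into a
    quadratic bound, using \<open>norm v \<le> 2 * b\<close>.\<close>
  define \<kappa>' where "\<kappa>' = min \<kappa> (\<kappa> * \<delta> / (4 * b))"
  show ?thesis
  proof (rule that)
    show "0 < \<kappa>'" "0 < 2 * b" using dk b by (simp_all add: \<kappa>'_def)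
    fix x v assume x: "x \<in> frontier \<Omega>" and v: "x + v \<in> \<Omega>"
    have xc: "x \<in> closure \<Omega>" using x by (simp add: frontier_def)
    have vc: "x + v \<in> closure \<Omega>" using v closure_subset by blast
    have vD: "norm v \<le> 2 * b"
      using b(2)[OF xc] b(2)[OF vc] norm_triangle_ineq4[of "x + v" x] by simp
    have "\<kappa>' * (norm v)\<^sup>2 \<le> nu x \<bullet> v"
    proof (cases "norm v < \<delta>")
      case True
      have "\<kappa>' * (norm v)\<^sup>2 \<le> \<kappa> * (norm v)\<^sup>2" by (intro mult_right_mono) (auto simp: \<kappa>'_def)
      then show ?thesis using dk(3)[OF x vc True] by linarith
    next
      case False
      define a where "a = \<delta> / (2 * norm v)"
      have nv: "0 < norm v" using False dk(1) by linarith
      have a: "0 < a" "a \<le> 1" "a * norm v = \<delta> / 2"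
        using False dk(1) nv by (auto simp: a_def field_simps)
      have "(1 - a) *\<^sub>R x + a *\<^sub>R (x + v) \<in> closure \<Omega>"
        using a by (intro convexD_alt[OF convex_closure[OF convex_Omega] xc vc]) auto
      then have av: "x + a *\<^sub>R v \<in> closure \<Omega>" by (simp add: algebra_simps)
      have nav: "norm (a *\<^sub>R v) = \<delta> / 2" using a by simp
      have "\<kappa> * (\<delta> / 2)\<^sup>2 \<le> a * (nu x \<bullet> v)"
        using dk(3)[OF x av] dk(1) unfolding nav by simp
      then have "norm v * (\<kappa> * (\<delta> / 2)\<^sup>2) \<le> norm v * (a * (nu x \<bullet> v))"
        by (intro mult_left_mono) auto
      also have "\<dots> = \<delta> / 2 * (nu x \<bullet> v)" unfolding a(3)[symmetric] by (simp only: mult_ac)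
      finally have "\<delta> / 2 * (\<kappa> * \<delta> / 2 * norm v) \<le> \<delta> / 2 * (nu x \<bullet> v)"
        by (simp add: power2_eq_square algebra_simps)
      then have 1: "\<kappa> * \<delta> / 2 * norm v \<le> nu x \<bullet> v"
        by (rule mult_left_le_imp_le) (use dk(1) in simp)
      have "\<kappa>' * (norm v)\<^sup>2 \<le> \<kappa> * \<delta> / (4 * b) * (norm v)\<^sup>2"
        by (intro mult_right_mono) (auto simp: \<kappa>'_def)
      also have "\<dots> = \<kappa> * \<delta> / (4 * b) * norm v * norm v" by (simp add: power2_eq_square)
      also have "\<dots> \<le> \<kappa> * \<delta> / (4 * b) * norm v * (2 * b)"
        using vD dk b by (intro mult_left_mono) auto
      also have "\<dots> = \<kappa> * \<delta> / 2 * norm v" using b(1) by simp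
      finally show ?thesis using 1 by linarith
    qed
    with vD show "norm v \<le> 2 * b \<and> \<kappa>' * (norm v)\<^sup>2 \<le> nu x \<bullet> v" by blast
  qed
qed

section \<open>The boundary model from the Taylor expansion\<close>

text \<open>Symmetrizing builds in the symmetry required by \<open>real_form\<close> and leaves the
  quadratic form unchanged. Division by the gradient norm normalizes the linear term to the unit
  normal.\<close>

definition form :: "complex ^ 'n \<Rightarrow> complex ^ 'n \<Rightarrow> complex ^ 'n \<Rightarrow> real" where
  "form x v w = (H x v \<bullet> w + H x w \<bullet> v) / (2 * norm (g x))"

lemma real_form_form: "real_form (form x)"
proof (rule real_form.intro)
  have "linear (form x v)" "linear (\<lambda>v. form x v w)" for v w
    by (rule linearI; simp add: form_def blinfun.add_right blinfun.scaleR_right inner_simps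
        add_divide_distrib algebra_simps)+
  then show "bounded_bilinear (form x)"
    by (simp add: bilinear_conv_bounded_bilinear[symmetric] bilinear_def)
qed (simp add: form_def)

text \<open>The error is weighted, linear in the normal and quadratic in the tangential coordinate,
  to match the parabolic scaling by \<open>t\<close> and \<open>sqrt t\<close>.\<close>

lemma taylor_form:
  assumes x: "x \<in> frontier \<Omega>" and m: "0 < m" "m \<le> norm (g x)" and A: "norm (H x) \<le> A"
    and eta: "0 < \<eta>" and v: "norm v \<le> \<eta> * m / (\<eta> * m + 2 * A)"
    and mod: "\<And>y. norm (y - x) \<le> norm v \<Longrightarrow> norm (H y - H x) \<le> \<eta> * m"
  shows "\<bar>2 * \<rho> (x + v) / norm (g x) + 2 * Re (zc (nu x) v) - form x (tp (nu x) v) (tp (nu x) v)\<bar>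
    \<le> \<eta> * (cmod (zc (nu x) v) + (norm (tp (nu x) v))\<^sup>2)"
proof -
  let ?z = "cmod (zc (nu x) v)" and ?p = "tp (nu x) v"
  let ?E = "?z + (norm ?p)\<^sup>2"
  have A0: "0 \<le> A" using A norm_ge_zero order_trans by blast
  have g0: "0 < norm (g x)" using m by linarith
  obtain y where y: "norm (y - x) \<le> norm v" "2 * \<rho> (x + v) = 2 * (g x \<bullet> v) + H y v \<bullet> v"
    by (rule taylor2[OF x])
  have e: "2 * \<rho> (x + v) = H y v \<bullet> v - 2 * norm (g x) * (nu x \<bullet> v)"
    using y(2) g_inner[OF x, of v] by simp
  have vp: "norm (v - ?p) = ?z" using norm_nu[OF x] by (simp add: tp_def norm_vector_smult)
  have em: "0 < \<eta> * m" using eta m by simp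
  have "\<bar>H y v \<bullet> v - H x ?p \<bullet> ?p\<bar> \<le> \<eta> * m * (norm v)\<^sup>2 + 2 * A * ?z * norm v"
    using hessian_perturb[OF A mod[OF y(1)] norm_tp_le[OF norm_nu[OF x], of v]] by (simp add: vp)
  also have "(norm v)\<^sup>2 \<le> norm v * ?z + (norm ?p)\<^sup>2"
    using norm_zc_tp[OF norm_nu[OF x], of v] norm_zc_le[OF norm_nu[OF x], of v]
    by (simp add: power2_eq_square mult_right_mono)
  then have "\<eta> * m * (norm v)\<^sup>2 \<le> \<eta> * m * (norm v * ?z + (norm ?p)\<^sup>2)"
    using em by (intro mult_left_mono) auto
  then have "\<eta> * m * (norm v)\<^sup>2 + 2 * A * ?z * norm v
      \<le> ((\<eta> * m + 2 * A) * norm v) * ?z + \<eta> * m * (norm ?p)\<^sup>2"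
    by (simp add: algebra_simps)
  \<comment> \<open>The radius imposed on \<open>v\<close> is the one that bounds the coefficient of
    the normal coordinate by \<open>\<eta> * m\<close>.\<close>
  also have "(\<eta> * m + 2 * A) * norm v \<le> \<eta> * m"
    using v em A0 by (simp add: pos_le_divide_eq mult.commute)
  then have "((\<eta> * m + 2 * A) * norm v) * ?z \<le> \<eta> * m * ?z" by (intro mult_right_mono) auto
  then have "((\<eta> * m + 2 * A) * norm v) * ?z + \<eta> * m * (norm ?p)\<^sup>2 \<le> \<eta> * m * ?E"
    by (simp add: algebra_simps)
  also have "\<eta> * m * ?E \<le> \<eta> * ?E * norm (g x)"
  proof -
    have "m * ?E \<le> norm (g x) * ?E" using m(2) by (intro mult_right_mono) auto
    then have "\<eta> * (m * ?E) \<le> \<eta> * (norm (g x) * ?E)" using eta by (intro mult_left_mono) auto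
    then show ?thesis by (simp only: mult.commute mult.left_commute)
  qed
  finally have err: "\<bar>H y v \<bullet> v - H x ?p \<bullet> ?p\<bar> / norm (g x) \<le> \<eta> * ?E"
    using g0 by (simp add: pos_divide_le_eq)
  have "2 * \<rho> (x + v) / norm (g x) + 2 * Re (zc (nu x) v) - form x ?p ?p
      = (H y v \<bullet> v - H x ?p \<bullet> ?p) / norm (g x)"
    using g0 unfolding e by (simp add: Re_zc form_def field_simps)
  with err show ?thesis using g0 by simp
qed

lemma uniform_boundary_model:
  "\<exists>\<kappa> c M D r. 0 < \<kappa> \<and> 0 < c \<and> 1 \<le> M \<and> 0 < D \<and> (\<forall>\<eta>>0. 0 < r \<eta>) \<and>
    (\<forall>x\<in>frontier \<Omega>. boundary_model (form x) \<kappa> c M D r \<Omega> x (nu x))"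
proof -
  obtain m G where mG: "0 < m" "0 < G" "\<And>x. x \<in> frontier \<Omega> \<Longrightarrow> m \<le> norm (g x) \<and> norm (g x) \<le> G"
    by (rule gradient_bounds) blast
  obtain A where A: "0 \<le> A" "\<And>x. x \<in> frontier \<Omega> \<Longrightarrow> norm (H x) \<le> A"
    by (rule hessian_bound) blast
  obtain c where c: "0 < c" "\<And>x v. x \<in> frontier \<Omega> \<Longrightarrow> g x \<bullet> v = 0 \<Longrightarrow> c * (norm v)\<^sup>2 \<le> H x v \<bullet> v"
    by (rule hessian_lower) blast
  obtain \<kappa> D where kD: "0 < \<kappa>" "0 < D"
    "\<And>x v. x \<in> frontier \<Omega> \<Longrightarrow> x + v \<in> \<Omega> \<Longrightarrow> norm v \<le> D \<and> \<kappa> * (norm v)\<^sup>2 \<le> nu x \<bullet> v"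
    by (rule global_support) blast
  have "\<forall>\<omega>. \<exists>r. 0 < \<omega> \<longrightarrow> 0 < r \<and> (\<forall>x\<in>frontier \<Omega>. \<forall>y. norm (y - x) < r \<longrightarrow> norm (H y - H x) \<le> \<omega>)"
    using hessian_modulus by blast
  then obtain R where R: "\<And>\<omega>. 0 < \<omega> \<Longrightarrow> 0 < R \<omega>"
    "\<And>\<omega> x y. 0 < \<omega> \<Longrightarrow> x \<in> frontier \<Omega> \<Longrightarrow> norm (y - x) < R \<omega> \<Longrightarrow> norm (H y - H x) \<le> \<omega>"
    by metis
  \<comment> \<open>The first entry controls the oscillation of the Hessian, the second is the
    radius demanded by \<open>taylor_form\<close>.\<close>
  define r where "r \<eta> = min (R (\<eta> * m)) (\<eta> * m / (\<eta> * m + 2 * A))" for \<eta> :: real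
  have k: "0 < \<kappa>" "0 < c / G" "1 \<le> max 1 (A / m)" "0 < D" using kD c mG by auto
  show ?thesis
  proof (intro exI conjI ballI allI impI)
    show "0 < \<kappa>" "0 < c / G" "1 \<le> max 1 (A / m)" "0 < D" by (fact k)+
    show r_pos: "0 < r \<eta>" if "0 < \<eta>" for \<eta>
      using that mG(1) A(1) R(1)[of "\<eta> * m"] by (simp add: r_def add_pos_nonneg)
    fix x assume x: "x \<in> frontier \<Omega>"
    have g0: "0 < norm (g x)" "m \<le> norm (g x)" "norm (g x) \<le> G" using mG(1) mG(3)[OF x] by linarith+
    have tay: "\<bar>2 * \<rho> (x + v) / norm (g x) + 2 * Re (zc (nu x) v) - form x (tp (nu x) v) (tp (nu x) v)\<bar>
      \<le> \<eta> * (cmod (zc (nu x) v) + (norm (tp (nu x) v))\<^sup>2)" if "0 < \<eta>" "norm v < r \<eta>" for \<eta> v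
      by (rule taylor_form[OF x mG(1) g0(2) A(2)[OF x] that(1)])
        (use that R(2)[OF _ x] mG(1) in \<open>auto simp: r_def\<close>)
    have sgn: "x + v \<in> \<Omega> \<longleftrightarrow> 2 * \<rho> (x + v) / norm (g x) < 0" for v
      using g0(1) Omega_eq by (auto simp: divide_less_0_iff)
    show "boundary_model (form x) \<kappa> (c / G) (max 1 (A / m)) D r \<Omega> x (nu x)"
    proof (intro boundary_model.intro real_form_form boundary_model_axioms.intro k r_pos)
      show "norm (nu x) = 1" by (rule norm_nu[OF x])
      show "x \<notin> \<Omega>" by (rule frontier_not_in[OF x])
      show "c / G * (norm v)\<^sup>2 \<le> form x v v" if "zc (nu x) v = 0" for v
      proof -
        have "g x \<bullet> v = 0" using that Re_zc[of "nu x" v] g_inner[OF x, of v] by simp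
        then have "c * (norm v)\<^sup>2 / norm (g x) \<le> form x v v"
          using c(2)[OF x] g0(1) by (simp add: form_def divide_right_mono)
        moreover have "c * (norm v)\<^sup>2 / G \<le> c * (norm v)\<^sup>2 / norm (g x)"
          using g0 c(1) mG(2) by (intro divide_left_mono) auto
        ultimately show ?thesis by simp
      qed
      show "\<bar>form x v w\<bar> \<le> max 1 (A / m) * norm v * norm w" for v w
      proof -
        have "\<bar>H x v \<bullet> w + H x w \<bullet> v\<bar> \<le> 2 * (A * norm v * norm w)"
          using blinfun_inner_le[OF A(2)[OF x], of v w] blinfun_inner_le[OF A(2)[OF x], of w v] by (simp add: algebra_simps)
        then have "\<bar>form x v w\<bar> \<le> (A * norm v * norm w) / norm (g x)"
          using g0(1) by (simp add: form_def abs_divide pos_divide_le_eq pos_le_divide_eq)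
        also have "\<dots> \<le> (A * norm v * norm w) / m"
          using g0 A(1) mG(1) by (intro divide_left_mono) auto
        also have "\<dots> = A / m * (norm v * norm w)" by simp
        also have "\<dots> \<le> max 1 (A / m) * (norm v * norm w)" by (intro mult_right_mono) auto
        finally show ?thesis by (simp add: mult.assoc)
      qed
      show "norm v \<le> D" "\<kappa> * (norm v)\<^sup>2 \<le> Re (zc (nu x) v)" if "x + v \<in> \<Omega>" for v
        using kD(3)[OF x that] by (simp_all add: Re_zc)
      show "form x (tp (nu x) v) (tp (nu x) v) - \<eta> * (cmod (zc (nu x) v) + (norm (tp (nu x) v))\<^sup>2) \<le> 2 * Re (zc (nu x) v)"
        if "0 < \<eta>" "norm v < r \<eta>" "x + v \<in> \<Omega>" for \<eta> v
        using tay[OF that(1,2)] that(3) unfolding sgn abs_le_iff by linarith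
      show "x + v \<in> \<Omega>" if "0 < \<eta>" "norm v < r \<eta>"
        "form x (tp (nu x) v) (tp (nu x) v) + \<eta> * (cmod (zc (nu x) v) + (norm (tp (nu x) v))\<^sup>2) < 2 * Re (zc (nu x) v)" for \<eta> v
        using tay[OF that(1,2)] that(3) unfolding sgn abs_le_iff by linarith
    qed
  qed
qed

section \<open>Nearest boundary points and the limit\<close>

text \<open>The ball about \<open>q\<close> reaching to \<open>x\<close> lies in the domain, so
  \<open>\<rho>\<close> cannot increase from \<open>x\<close> in directions pointing into it. This
  forces the gradient to be a negative multiple of \<open>q - x\<close>.\<close>

lemma nearest_boundary_point:
  assumes q: "q \<in> \<Omega>" and p: "p \<in> frontier \<Omega>"
  obtains x s where "x \<in> frontier \<Omega>" "0 < s" "s \<le> dist q p" "q = x + s *\<^sub>R nu x"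
proof -
  obtain x where x: "x \<in> frontier \<Omega>" "\<And>y. y \<in> frontier \<Omega> \<Longrightarrow> dist q x \<le> dist q y"
    using distance_attains_inf[OF frontier_closed fr_nonempty, of q] by blast
  define u where "u = q - x"
  define d where "d = norm u"
  have "q \<noteq> x" using q frontier_not_in[OF x(1)] by blast
  then have u0: "u \<noteq> 0" "0 < d" by (simp_all add: u_def d_def)
  have dq: "dist q x = d" by (simp add: d_def u_def dist_norm)
  have "ball q d \<inter> frontier \<Omega> = {}" using x(2) dq by force
  moreover have "q \<in> ball q d \<inter> \<Omega>" using q u0(2) by simp
  ultimately have ball: "ball q d \<subseteq> \<Omega>"
    using connected_Int_frontier[OF connected_ball, of q d \<Omega>] by blast
  have dir: "g x \<bullet> v \<le> 0" if v: "0 < v \<bullet> u" for v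
  proof (rule ccontr)
    assume "\<not> g x \<bullet> v \<le> 0"
    then have "0 < g x \<bullet> v" by simp
    moreover have "((\<lambda>t. \<rho> (x + t *\<^sub>R v)) has_real_derivative (g x \<bullet> v)) (at 0)"
      using DERIV_rho_line[of x v 0] by simp
    ultimately obtain e where e: "0 < e" "\<And>h. 0 < h \<Longrightarrow> h < e \<Longrightarrow> \<rho> x < \<rho> (x + h *\<^sub>R v)"
      using DERIV_pos_inc_right[of "\<lambda>t. \<rho> (x + t *\<^sub>R v)" "g x \<bullet> v" 0] by auto
    have v0: "v \<noteq> 0" using v by auto
    define h where "h = min (e / 2) ((v \<bullet> u) / (norm v)\<^sup>2)"
    have h: "0 < h" "h < e" "h * (norm v)\<^sup>2 \<le> v \<bullet> u"
      using e(1) v v0 by (auto simp: h_def min_def field_simps)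
    have "(norm (u - h *\<^sub>R v))\<^sup>2 = d\<^sup>2 - h * (2 * (v \<bullet> u) - h * (norm v)\<^sup>2)"
      unfolding d_def power2_norm_eq_inner by (simp add: inner_simps inner_commute algebra_simps)
    also have "\<dots> < d\<^sup>2" using h v by (simp add: zero_less_mult_iff)
    finally have "norm (u - h *\<^sub>R v) < d" using u0 by (auto dest: power2_less_imp_less)
    then have "x + h *\<^sub>R v \<in> ball q d" by (simp add: dist_norm u_def algebra_simps)
    then have "\<rho> (x + h *\<^sub>R v) < 0" using ball Omega_eq by auto
    with e(2)[OF h(1,2)] rho_frontier[OF x(1)] show False by simp
  qed
  \<comment> \<open>If the component \<open>w\<close> of the gradient orthogonal to \<open>u\<close>
    were nonzero, tilting it slightly towards \<open>u\<close> would give a direction into the ball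
    along which \<open>\<rho>\<close> increases.\<close>
  define k where "k = (g x \<bullet> u) / (u \<bullet> u)"
  define w where "w = g x - k *\<^sub>R u"
  have uu: "0 < u \<bullet> u" using u0 by simp
  have wu: "w \<bullet> u = 0" using uu by (simp add: w_def k_def inner_simps)
  have gw: "g x \<bullet> w = w \<bullet> w"
    using wu by (simp add: w_def inner_simps inner_commute)
  have gu: "g x \<bullet> u \<le> 0" by (rule dir) (rule uu)
  have "w = 0"
  proof (rule ccontr)
    assume "w \<noteq> 0"
    then have ww: "0 < w \<bullet> w" by simp
    \<comment> \<open>The added 1 keeps the divisor positive; with \<open>s\<close> as below, the
      derivative along the tilted direction is \<open>w \<bullet> w / 2 + s\<close>.\<close>
    define k1 where "k1 = 1 - g x \<bullet> u"
    have k1: "0 < k1" using gu by (simp add: k1_def)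
    define s where "s = (w \<bullet> w) / (2 * k1)"
    have s: "0 < s" "s * k1 = w \<bullet> w / 2" using ww k1 by (simp_all add: s_def)
    have "g x \<bullet> (w + s *\<^sub>R u) \<le> 0" by (rule dir) (use s(1) uu wu in \<open>simp add: inner_simps\<close>)
    then show False using s ww by (simp add: inner_simps gw k1_def algebra_simps)
  qed
  then have gk: "g x = k *\<^sub>R u" by (simp add: w_def)
  have "k < 0" using gk g_nonzero[OF x(1)] gu uu
    by (metis k_def divide_nonpos_pos order_le_less scaleR_zero_left)
  then have "d *\<^sub>R nu x = u" using u0 by (simp add: nu_def gk d_def)
  then have "q = x + d *\<^sub>R nu x" by (simp add: u_def)
  moreover have "d \<le> dist q p" using x(2)[OF p] dq by simp
  ultimately show ?thesis using that x(1) u0(2) by blast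
qed

text \<open>The nearest boundary point changes with \<open>q\<close>, but its distance
  \<open>s\<close> is at most \<open>dist q p\<close>, so the uniform estimate applies.\<close>

lemma squeezing_tendsto_1:
  assumes p: "p \<in> frontier \<Omega>"
  shows "(squeezing \<Omega> \<longlongrightarrow> 1) (at p within \<Omega>)"
proof (rule tendstoI)
  fix e :: real assume e: "0 < e"
  \<comment> \<open>Chosen for \<open>2 * \<epsilon> < e\<close>, as the final ratio is at least
    \<open>1 - 2 * \<epsilon>\<close>.\<close>
  define \<epsilon> where "\<epsilon> = min (1 / 2) (e / 4)"
  have eps: "0 < \<epsilon>" "\<epsilon> < 1" "2 * \<epsilon> < e" using e by (auto simp: \<epsilon>_def)
  obtain \<kappa> c M D r where bm: "0 < \<kappa>" "0 < c" "1 \<le> M" "0 < D" "\<forall>\<eta>>0. 0 < r \<eta>"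
    "\<forall>x\<in>frontier \<Omega>. boundary_model (form x) \<kappa> c M D r \<Omega> x (nu x)"
    using uniform_boundary_model by blast
  from bm(5) have r_pos: "0 < r \<eta>" if "0 < \<eta>" for \<eta> using that by blast
  from squeezing_uniformly_near_one[where r = r and 'n = 'n, OF bm(1-4) r_pos eps(1,2)]
  obtain s0 where s0: "0 < s0"
    "\<And>x s. x \<in> frontier \<Omega> \<Longrightarrow> x + s *\<^sub>R nu x \<in> \<Omega> \<Longrightarrow> 0 < s \<Longrightarrow> s < s0 \<Longrightarrow>
      (1 - \<epsilon>) / (1 + \<epsilon>) \<le> squeezing \<Omega> (x + s *\<^sub>R nu x) \<and> squeezing \<Omega> (x + s *\<^sub>R nu x) \<le> 1"
    using bm(6) by blast
  have "dist (squeezing \<Omega> q) 1 < e" if q: "q \<in> \<Omega>" "dist q p < s0" for q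
  proof -
    obtain x s where x: "x \<in> frontier \<Omega>" "0 < s" "s \<le> dist q p" "q = x + s *\<^sub>R nu x"
      by (rule nearest_boundary_point[OF q(1) p])
    have "(1 - \<epsilon>) / (1 + \<epsilon>) \<le> squeezing \<Omega> q" "squeezing \<Omega> q \<le> 1"
      using s0(2)[OF x(1), of s] q x by auto
    moreover have "1 - 2 * \<epsilon> \<le> (1 - \<epsilon>) / (1 + \<epsilon>)"
      by (subst pos_le_divide_eq) (use eps in \<open>auto simp: algebra_simps\<close>)
    ultimately show ?thesis using eps(3) by (simp add: dist_real_def abs_if)
  qed
  then show "\<forall>\<^sub>F q in at p within \<Omega>. dist (squeezing \<Omega> q) 1 < e"
    unfolding eventually_at using s0(1) by blast
qed

end

theorem theorem2:
  fixes \<Omega> :: "(complex ^ 'n) set" and p :: "complex ^ 'n"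
  assumes "open \<Omega>" and "connected \<Omega>" and "\<Omega> \<noteq> {}" and "bounded \<Omega>"
    and "strongly_convex_C2_boundary \<Omega>"
    and "p \<in> frontier \<Omega>"
  shows "(squeezing \<Omega> \<longlongrightarrow> 1) (at p within \<Omega>)"
proof -
  obtain \<rho> g H where "C2_defining_function \<Omega> \<rho> g H"
    "\<And>x v. x \<in> frontier \<Omega> \<Longrightarrow> v \<noteq> 0 \<Longrightarrow> g x \<bullet> v = 0 \<Longrightarrow> 0 < blinfun_apply (H x) v \<bullet> v"
    using assms(5) unfolding strongly_convex_C2_boundary_def by blast
  then interpret strongly_convex_domain \<Omega> \<rho> g H
    using assms by unfold_locales auto
  show ?thesis by (rule squeezing_tendsto_1[OF assms(6)])
qed

end
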